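(* Let $k\geqslant 4$ be a fixed integer and consider the random $K_k$-removal algorithm on the vertex set $[n]$. Let $M$ be the number of steps it takes the process to terminate and let $E(M)$ be the edge set of the resulting $K_k$-free graph $G(M)$. Then, with high probability (i.e. with probability tending to $1$ as $n\to\infty$), $$|E(M)|\leqslant n^{2-\frac{1}{k(k-1)-2}+o(1)}.$$
   Context: The random $K_k$-removal algorithm: start with $G(0)$ the complete graph on vertex set $[n]=\{1,\dots,n\}$. Given $G(i)$, the graph $G(i+1)$ is obtained by choosing one copy of $K_k$ uniformly at random among all copies of $K_k$ in $G(i)$ and deleting all of its edges. The algorithm stops at the hitting time $M=\min\{i: G(i)\text{ is }K_k\text{-free}\}$. $E(i)$ denotes the edge set of $G(i)$. Asymptotics are as $n\to\infty$. *)

theory Defs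
  imports "HOL-Probability.Probability" "HOL-Library.Ramsey" "HOL-Library.Landau_Symbols"
begin

text \<open>
  A graph on the vertex set \<open>{1..n}\<close> is represented by its set of edges, the complete graph being
  \<open>[{1..n}]\<^bsup>2\<^esup>\<close> (the set of all 2-element subsets). A copy of \<open>K\<^sub>k\<close> is represented by its set of
  edges, too; for \<open>k \<ge> 2\<close> this determines its vertex set.
\<close>

type_synonym edges = "nat set set"

definition clique_copies :: "nat \<Rightarrow> nat \<Rightarrow> edges \<Rightarrow> edges set" where
  "clique_copies k n E = {[S]\<^bsup>2\<^esup> | S. S \<in> [{1..n}]\<^bsup>k\<^esup> \<and> [S]\<^bsup>2\<^esup> \<subseteq> E}"

definition clique_free :: "nat \<Rightarrow> nat \<Rightarrow> edges \<Rightarrow> bool" where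
  "clique_free k n E \<longleftrightarrow> clique_copies k n E = {}"

lemma finite_clique_copies [simp]: "finite (clique_copies k n E)"
proof -
  have "clique_copies k n E \<subseteq> (\<lambda>S. [S]\<^bsup>2\<^esup>) ` [{1..n}]\<^bsup>k\<^esup>"
    by (auto simp: clique_copies_def)
  then show ?thesis
    by (rule finite_subset) (simp add: finite_imp_finite_nsets)
qed

text \<open>
  Law of \<open>G(i + 1)\<close> given \<open>G(i) = E\<close>. It is only meaningful if \<open>E\<close> contains a copy of \<open>K\<^sub>k\<close>.
\<close>

definition removal_step :: "nat \<Rightarrow> nat \<Rightarrow> edges \<Rightarrow> edges pmf" where
  "removal_step k n E = map_pmf (\<lambda>F. E - F) (pmf_of_set (clique_copies k n E))"

lemma removal_step_decreases:
  assumes "k \<ge> 2" "\<not> clique_free k n E" "E' \<in> set_pmf (removal_step k n E)"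
  shows "card (E' \<inter> [{1..n}]\<^bsup>2\<^esup>) < card (E \<inter> [{1..n}]\<^bsup>2\<^esup>)"
proof -
  from assms(2,3) obtain S where S: "S \<in> [{1..n}]\<^bsup>k\<^esup>" "[S]\<^bsup>2\<^esup> \<subseteq> E" and E': "E' = E - [S]\<^bsup>2\<^esup>"
    by (auto simp: removal_step_def clique_free_def set_pmf_of_set) (auto simp: clique_copies_def)
  have "[S]\<^bsup>2\<^esup> \<noteq> {}"
    using S(1) assms(1) by (simp add: nsets_eq_empty_iff) (auto simp: nsets_def)
  moreover have "[S]\<^bsup>2\<^esup> \<subseteq> [{1..n}]\<^bsup>2\<^esup>"
    using S(1) by (auto simp: nsets_def)
  ultimately have "E' \<inter> [{1..n}]\<^bsup>2\<^esup> \<subset> E \<inter> [{1..n}]\<^bsup>2\<^esup>"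
    using S(2) E' by blast
  then show ?thesis
    by (rule psubset_card_mono[rotated]) (simp add: finite_imp_finite_nsets)
qed

text \<open>
  Law of the whole trajectory \<open>[G(0), \<dots>, G(M)]\<close> of the random \<open>K\<^sub>k\<close>-removal algorithm started at
  \<open>G(0) = E\<close>. The guard \<open>k < 2\<close> only serves to make the function total: for \<open>k < 2\<close> a copy of
  \<open>K\<^sub>k\<close> has no edges, and the algorithm may run forever.
\<close>

function removal_process :: "nat \<Rightarrow> nat \<Rightarrow> edges \<Rightarrow> edges list pmf" where
  "removal_process k n E =
    (if k < 2 \<or> clique_free k n E then return_pmf [E]
     else bind_pmf (removal_step k n E) (\<lambda>E'. map_pmf ((#) E) (removal_process k n E')))"
  by auto
termination
proof (relation "Wellfounded.measure (\<lambda>(k, n, E). card (E \<inter> [{1..n}]\<^bsup>2\<^esup>))")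
  fix k n E E'
  assume "\<not> (k < 2 \<or> clique_free k n E)" "E' \<in> set_pmf (removal_step k n E)"
  then show "((k, n, E'), (k, n, E)) \<in> Wellfounded.measure (\<lambda>(k, n, E). card (E \<inter> [{1..n}]\<^bsup>2\<^esup>))"
    using removal_step_decreases[of k n E E'] by simp
qed simp

declare removal_process.simps [simp del]

definition hitting_time :: "nat \<Rightarrow> nat \<Rightarrow> edges list \<Rightarrow> nat" where
  "hitting_time k n G = (LEAST i. i < length G \<and> clique_free k n (G ! i))"

text \<open>
  The hitting time is well-defined on every possible trajectory: it is the index of the last entry.
\<close>

lemma removal_process_support:
  assumes "k \<ge> 2" "G \<in> set_pmf (removal_process k n E)"
  shows "G \<noteq> []" "G ! 0 = E"
    "i < length G \<Longrightarrow> clique_free k n (G ! i) \<longleftrightarrow> Suc i = length G"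
    "Suc i < length G \<Longrightarrow> G ! Suc i \<in> set_pmf (removal_step k n (G ! i))"
proof -
  have "G \<noteq> [] \<and> G ! 0 = E \<and>
      (\<forall>i < length G. clique_free k n (G ! i) \<longleftrightarrow> Suc i = length G) \<and>
      (\<forall>i. Suc i < length G \<longrightarrow> G ! Suc i \<in> set_pmf (removal_step k n (G ! i)))"
    using assms
  proof (induction k n E arbitrary: G rule: removal_process.induct)
    case (1 k n E)
    show ?case
    proof (cases "clique_free k n E")
      case True
      with 1 show ?thesis by (simp add: removal_process.simps)
    next
      case False
      with 1(2,3) obtain E' G' where E': "E' \<in> set_pmf (removal_step k n E)"
        and G': "G' \<in> set_pmf (removal_process k n E')" and G: "G = E # G'"
        by (subst (asm) removal_process.simps) auto
      have "\<not> (k < 2 \<or> clique_free k n E)"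
        using False 1(2) by simp
      from 1(1)[OF this E' 1(2) G'] False E' show ?thesis
        by (auto simp: G nth_Cons split: nat.splits)
    qed
  qed
  then show "G \<noteq> []" "G ! 0 = E"
    "i < length G \<Longrightarrow> clique_free k n (G ! i) \<longleftrightarrow> Suc i = length G"
    "Suc i < length G \<Longrightarrow> G ! Suc i \<in> set_pmf (removal_step k n (G ! i))"
    by blast+
qed

lemma hitting_time_removal_process:
  assumes "k \<ge> 2" "G \<in> set_pmf (removal_process k n E)"
  shows "Suc (hitting_time k n G) = length G"
proof -
  note * = removal_process_support[OF assms]
  have "hitting_time k n G = length G - 1"
    unfolding hitting_time_def using *(1,3) by (intro Least_equality) auto
  with *(1) show ?thesis by simp
qed

end

theory Submission
  imports Defs "HOL-Real_Asymp.Real_Asymp"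
begin

text \<open>
  Consider the process on \<open>k\<close>-cliques as a random greedy matching in the hypergraph whose vertices are
  the edges \<open>e\<close> of the graph and whose hyperedges are the cliques. Let \<open>Y e\<close> be the degree of \<open>e\<close>,
  \<open>y\<close> its initial value, \<open>Q\<close> the number of cliques and \<open>m = k choose 2\<close>. The degrees are compared not
  with a function of the number of edges, which would require sharp control of \<open>Q\<close>, but with a
  random clock \<open>x\<close> that starts at \<open>1\<close> and grows by \<open>(m - 1) * y / Q\<close> in each step. Then
  \<open>v e = x * Y e / y\<close> has relative drift \<open>(\<Delta>x / x) * (1 - average of v f over neighbours f)\<close>, so a
  deviation of order \<open>r = A * x powr (1 + \<epsilon>)\<close> of all \<open>v e\<close> from \<open>1\<close> causes a drift of at most about
  \<open>r * \<Delta>x / x\<close>, whereas \<open>r\<close> itself grows by \<open>(1 + \<epsilon>) * r * \<Delta>x / x\<close>. For \<open>A = n powr (\<epsilon> - 1/2)\<close> the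
  spare \<open>\<epsilon> * r * \<Delta>x / x\<close> also absorbs the second moment of the increments, and
  \<open>\<Sum>e. exp (l * (\<bar>v e - 1\<bar> - r))\<close> is a supermartingale while it is less than \<open>1\<close>; being less than
  \<open>1\<close> it forces every \<open>\<bar>v e - 1\<bar> < r\<close>, hence \<open>Y e > 0\<close>, and the process cannot stop. By induction along
  the recursion of the process its initial value, \<open>n\<^sup>2 * exp (- l * A)\<close>, bounds the probability of
  stopping before \<open>x\<close> reaches \<open>n powr (1/2 - 2 * \<epsilon>)\<close>. At that time the invariant
  \<open>|E| * x powr ((1 - \<epsilon>) / (m - 1)) \<le> n\<^sup>2\<close> gives the bound on the number of edges.
\<close>

subsection \<open>Degrees in a hypergraph\<close>

definition hdeg :: "'a set set \<Rightarrow> 'a \<Rightarrow> nat" where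
  "hdeg C e = card {D \<in> C. e \<in> D}"

text \<open>
  The loss of an edge \<open>e \<in> F\<close>, which disappears itself, is set to \<open>0\<close>: it then stays in the potential
  as if its degree had not changed, which only increases the potential.
\<close>

definition hloss :: "'a set set \<Rightarrow> 'a \<Rightarrow> 'a set \<Rightarrow> nat" where
  "hloss C e F = (if e \<in> F then 0 else card {D \<in> C. e \<in> D \<and> D \<inter> F \<noteq> {}})"

lemma card_filter_eq_sum:
  "finite A \<Longrightarrow> card {x \<in> A. P x} = (\<Sum>x\<in>A. if P x then 1 else 0)"
  by (simp add: sum.If_cases Int_def conj_commute)

lemma hdeg_delete:
  assumes "finite C" "e \<notin> F"
  shows "real (hdeg {D \<in> C. D \<inter> F = {}} e) = real (hdeg C e) - real (hloss C e F)"
proof -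
  have "{D \<in> C. e \<in> D} = {D \<in> {D \<in> C. D \<inter> F = {}}. e \<in> D} \<union> {D \<in> C. e \<in> D \<and> D \<inter> F \<noteq> {}}"
    by auto
  then have "hdeg C e = hdeg {D \<in> C. D \<inter> F = {}} e + card {D \<in> C. e \<in> D \<and> D \<inter> F \<noteq> {}}"
    unfolding hdeg_def using assms(1)
    by (simp only:) (rule card_Un_disjoint, auto)
  then show ?thesis using assms(2) by (simp add: hloss_def)
qed

text \<open>Double counting of incidences. It is used with \<open>D\<close> a clique minus one edge,
  to estimate the expected loss, and with \<open>D\<close> the whole edge set, to estimate the
  number of cliques.\<close>

lemma sum_hdeg:
  assumes "finite C" "finite D"
  shows "(\<Sum>e\<in>D. hdeg C e) = (\<Sum>F\<in>C. card (F \<inter> D))"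
proof -
  have "(\<Sum>e\<in>D. hdeg C e) = (\<Sum>e\<in>D. \<Sum>F\<in>C. if e \<in> F then 1 else 0)"
    unfolding hdeg_def using assms by (simp only: card_filter_eq_sum)
  also have "\<dots> = (\<Sum>F\<in>C. \<Sum>e\<in>D. if e \<in> F then 1 else 0)"
    by (rule sum.swap)
  also have "\<dots> = (\<Sum>F\<in>C. card {e \<in> D. e \<in> F})"
    using assms by (simp only: card_filter_eq_sum)
  also have "\<dots> = (\<Sum>F\<in>C. card (F \<inter> D))"
    by (intro sum.cong refl arg_cong[where f = card]) auto
  finally show ?thesis .
qed

text \<open>Both sides count pairs of a clique \<open>D\<close> through \<open>e\<close> and a
  removed clique \<open>F\<close> that destroys \<open>D\<close> but spares \<open>e\<close>. On the
  right, each summand is close to a sum of degrees.\<close>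

lemma sum_hloss:
  assumes "finite C"
  shows "(\<Sum>F\<in>C. hloss C e F) =
    (\<Sum>D\<in>{D \<in> C. e \<in> D}. card {F \<in> C. e \<notin> F \<and> F \<inter> D \<noteq> {}})"
proof -
  have fin: "finite {D \<in> C. e \<in> D}" using assms by simp
  have "hloss C e F = (\<Sum>D\<in>{D \<in> C. e \<in> D}. if e \<notin> F \<and> F \<inter> D \<noteq> {} then 1 else 0)" for F
  proof -
    have "{D \<in> C. e \<in> D \<and> D \<inter> F \<noteq> {}} = {D \<in> {D \<in> C. e \<in> D}. F \<inter> D \<noteq> {}}" by auto
    then show ?thesis
      using card_filter_eq_sum[OF fin, of "\<lambda>D. F \<inter> D \<noteq> {}"] by (auto simp: hloss_def)
  qed
  then have "(\<Sum>F\<in>C. hloss C e F) =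
      (\<Sum>F\<in>C. \<Sum>D\<in>{D \<in> C. e \<in> D}. if e \<notin> F \<and> F \<inter> D \<noteq> {} then 1 else 0)"
    by simp
  also have "\<dots> = (\<Sum>D\<in>{D \<in> C. e \<in> D}. \<Sum>F\<in>C. if e \<notin> F \<and> F \<inter> D \<noteq> {} then 1 else 0)"
    by (rule sum.swap)
  also have "\<dots> = (\<Sum>D\<in>{D \<in> C. e \<in> D}. card {F \<in> C. e \<notin> F \<and> F \<inter> D \<noteq> {}})"
    using assms by (simp only: card_filter_eq_sum)
  finally show ?thesis .
qed

subsection \<open>Elementary inequalities\<close>

lemma exp_le_quadratic:
  fixes z :: real
  assumes "\<bar>z\<bar> \<le> 1"
  shows "exp z \<le> 1 + z + z\<^sup>2"
proof (cases "z \<ge> 0")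
  case True
  with assms show ?thesis by (intro exp_bound) auto
next
  case False
  define y where "y = - z"
  have y: "y > 0" using False by (simp add: y_def)
  have "1 + y \<le> exp y" by (rule exp_ge_add_one_self)
  \<comment> \<open>For a negative argument, \<open>1 + y \<le> exp y\<close> is multiplied by
    \<open>1 - y + y^2\<close>, which turns the left side into \<open>1 + y^3\<close>.\<close>
  then have "1 \<le> exp y * (1 - y + y\<^sup>2)"
  proof -
    have p: "0 \<le> 1 - y + y\<^sup>2"
      using zero_le_power2[of "y - 1/2"] by (simp add: power2_eq_square algebra_simps)
    have "1 \<le> 1 + y ^ 3" using y by simp
    also have "\<dots> = (1 + y) * (1 - y + y\<^sup>2)"
      by (simp add: power2_eq_square power3_eq_cube algebra_simps)
    also have "\<dots> \<le> exp y * (1 - y + y\<^sup>2)"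
      using p \<open>1 + y \<le> exp y\<close> by (rule mult_right_mono[rotated])
    finally show ?thesis .
  qed
  then have "exp (- y) \<le> 1 - y + y\<^sup>2"
    by (simp add: exp_minus field_simps)
  then show ?thesis by (simp add: y_def)
qed

text \<open>Since the values lie between \<open>0\<close> and \<open>c\<close>, the second moment is
  at most \<open>c\<close> times the mean, so the mean also controls the quadratic term. Both signs
  of \<open>t\<close> occur later, one for each direction of deviation.\<close>

lemma mean_exp_le:
  fixes \<nu> :: "'b \<Rightarrow> real"
  assumes "finite S" "S \<noteq> {}" "\<And>F. F \<in> S \<Longrightarrow> 0 \<le> \<nu> F \<and> \<nu> F \<le> c" "\<bar>t\<bar> * c \<le> 1"
  defines "\<mu> \<equiv> (\<Sum>F\<in>S. \<nu> F) / card S"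
  shows "(\<Sum>F\<in>S. exp (t * \<nu> F)) / card S \<le> exp (t * \<mu> + t\<^sup>2 * c * \<mu>)"
proof -
  have card: "real (card S) > 0" using assms(1,2) by (simp add: card_gt_0_iff)
  have "exp (t * \<nu> F) \<le> 1 + (t + t\<^sup>2 * c) * \<nu> F" if "F \<in> S" for F
  proof -
    have \<nu>: "0 \<le> \<nu> F" "\<nu> F \<le> c" using assms(3)[OF that] by auto
    have "\<bar>t * \<nu> F\<bar> \<le> \<bar>t\<bar> * c"
      using \<nu> by (simp add: abs_mult mult_left_mono)
    then have "exp (t * \<nu> F) \<le> 1 + t * \<nu> F + (t * \<nu> F)\<^sup>2"
      using assms(4) by (intro exp_le_quadratic) simp
    also have "(t * \<nu> F)\<^sup>2 = t\<^sup>2 * (\<nu> F * \<nu> F)" by (simp add: power2_eq_square)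
    also have "\<dots> \<le> t\<^sup>2 * (c * \<nu> F)"
      using \<nu> by (intro mult_left_mono mult_right_mono) auto
    finally show ?thesis by (simp add: algebra_simps)
  qed
  then have "(\<Sum>F\<in>S. exp (t * \<nu> F)) \<le> (\<Sum>F\<in>S. 1 + (t + t\<^sup>2 * c) * \<nu> F)"
    by (rule sum_mono)
  also have "\<dots> = card S * (1 + (t + t\<^sup>2 * c) * \<mu>)"
    using card by (simp add: sum.distrib \<mu>_def distrib_left flip: sum_distrib_left)
  finally have "(\<Sum>F\<in>S. exp (t * \<nu> F)) / card S \<le> 1 + (t + t\<^sup>2 * c) * \<mu>"
    using card by (simp add: field_simps)
  also have "\<dots> \<le> exp ((t + t\<^sup>2 * c) * \<mu>)" by (rule exp_ge_add_one_self)
  finally show ?thesis by (simp add: algebra_simps)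
qed

text \<open>Bernoulli's inequality with a real exponent, proved by comparing derivatives of
  logarithms. It makes the allowance \<open>r\<close> grow by at least
  \<open>(1 + \<epsilon>) * r * w\<close> when the clock is multiplied by
  \<open>1 + w\<close>.\<close>

lemma powr_ge_tangent:
  fixes x w a :: real
  assumes "x > 0" "w \<ge> 0" "a \<ge> 1"
  shows "(x * (1 + w)) powr a \<ge> x powr a * (1 + a * w)"
proof -
  have "1 + a * w \<le> (1 + w) powr a"
  proof -
    have "ln (1 + a * w) \<le> a * ln (1 + w)"
    proof -
      have 1: "((\<lambda>w. a * ln (1 + w) - ln (1 + a * w)) has_real_derivative
          a * (1 / (1 + z)) - a / (1 + a * z)) (at z)" if "z \<ge> 0" for z
      proof -
        have "a * z \<ge> 0" using that assms by simp
        then show ?thesis using that by (auto intro!: derivative_eq_intros)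
      qed
      have 2: "a * (1 / (1 + z)) - a / (1 + a * z) \<ge> 0" if "z \<ge> 0" for z
      proof -
        have "z \<le> a * z" using that assms mult_right_mono[of 1 a z] by simp
        then have "a / (1 + a * z) \<le> a / (1 + z)" using that assms by (intro divide_left_mono) auto
        then show ?thesis by simp
      qed
      have "a * ln (1 + 0) - ln (1 + a * 0) \<le> a * ln (1 + w) - ln (1 + a * w)"
        using assms(2)
      proof (rule DERIV_nonneg_imp_nondecreasing)
        fix z :: real assume "0 \<le> z" "z \<le> w"
        then show "\<exists>y. ((\<lambda>w. a * ln (1 + w) - ln (1 + a * w)) has_real_derivative y) (at z) \<and> 0 \<le> y"
          using 1 2 by blast
      qed
      then show ?thesis by simp
    qed
    moreover have "1 + a * w > 0" using assms by (simp add: add_pos_nonneg)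
    ultimately have "1 + a * w \<le> exp (a * ln (1 + w))" by (metis exp_ln exp_le_cancel_iff)
    then show ?thesis using assms by (simp add: powr_def)
  qed
  then show ?thesis using assms by (simp add: powr_mult mult_left_mono)
qed


text \<open>
  Here \<open>w\<close> is the relative increment of the clock, \<open>v\<close> the rescaled degree, \<open>\<mu>\<close> its expected loss
  before rescaling, and the last summand comes from the second moment of the loss.
\<close>

lemma drift_le:
  fixes w v \<mu> c l r \<epsilon> :: real
  assumes "0 \<le> w" "0 \<le> c" "0 < l" "0 < \<epsilon>" "\<epsilon> \<le> 1" "0 \<le> r" "r \<le> \<epsilon> / 4" "\<bar>v - 1\<bar> \<le> r"
    and \<mu>: "w * v * (1 - r - c) \<le> \<mu>" "\<mu> \<le> w * v * (1 + r)"
    and small: "c * (1 + 8 * l) + 2 * w \<le> \<epsilon> * r / 4"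
  shows "w * v - (1 + w) * \<mu> + l * (1 + w)\<^sup>2 * c * \<mu> \<le> (1 + \<epsilon>) * r * w"
    and "(1 + w) * \<mu> - w * v + l * (1 + w)\<^sup>2 * c * \<mu> \<le> (1 + \<epsilon>) * r * w"
proof -
  have lc: "0 \<le> l * c" using assms by simp
  have er: "\<epsilon> * r \<le> 1 * (1 / 4)" using assms by (intro mult_mono) auto
  have "c * (1 + 8 * l) = c + 8 * (l * c)" by (simp add: algebra_simps)
  with small have small': "c + 8 * (l * c) + 2 * w \<le> \<epsilon> * r / 4" by simp
  have w1: "w \<le> 1" and c1: "c \<le> 1/4" using small' er lc assms(1,2) by linarith+
  have v: "0 < v" "v \<le> 1 + \<epsilon> / 4" using assms(4,5,7,8) by linarith+
  have wv: "0 \<le> w * v" using v assms by simp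
  have mu0: "0 \<le> \<mu>"
  proof -
    have "0 \<le> w * v * (1 - r - c)" using wv c1 assms(5,7) by (intro mult_nonneg_nonneg[of "w * v"]) auto
    with \<mu> show ?thesis by simp
  qed
  have mu2: "\<mu> \<le> 2 * (w * v)"
  proof -
    have "w * v * (1 + r) \<le> w * v * 2" using wv assms(5,7) by (intro mult_left_mono) auto
    with \<mu> show ?thesis by simp
  qed
  \<comment> \<open>The 8 is 4 * 2, from \<open>1 + w \<le> 2\<close> and
    \<open>\<mu> \<le> 2 * (w * v)\<close>; it is the 8 in the hypothesis
    \<open>small\<close>.\<close>
  have quad: "l * (1 + w)\<^sup>2 * c * \<mu> \<le> 8 * (l * c) * (w * v)"
  proof -
    have "(1 + w)\<^sup>2 \<le> 2\<^sup>2" using w1 assms(1) by (intro power_mono) auto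
    then have "(1 + w)\<^sup>2 * \<mu> \<le> 4 * (2 * (w * v))" using mu2 mu0 by (intro mult_mono) auto
    then have "l * c * ((1 + w)\<^sup>2 * \<mu>) \<le> l * c * (4 * (2 * (w * v)))"
      using lc by (rule mult_left_mono)
    then show ?thesis by (simp add: algebra_simps)
  qed
  \<comment> \<open>One factor \<open>1 + \<epsilon> / 4\<close> comes from the error terms and one
    from \<open>v\<close>; their product is at most \<open>1 + \<epsilon>\<close>.\<close>
  have final: "w * v * (r + \<epsilon> * r / 4) \<le> (1 + \<epsilon>) * r * w"
  proof -
    have "w * v * (r + \<epsilon> * r / 4) = w * r * (1 + \<epsilon> / 4) * v" by (simp add: algebra_simps)
    also have "\<dots> \<le> w * r * (1 + \<epsilon> / 4) * (1 + \<epsilon> / 4)"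
      using v assms by (intro mult_left_mono) auto
    also have "\<dots> = w * r * ((1 + \<epsilon> / 4) * (1 + \<epsilon> / 4))" by simp
    also have "\<dots> \<le> w * r * (1 + \<epsilon>)"
    proof (rule mult_left_mono)
      have "\<epsilon> * \<epsilon> \<le> \<epsilon>" using assms by (simp add: mult_left_le)
      moreover have "(1 + \<epsilon> / 4) * (1 + \<epsilon> / 4) = 1 + \<epsilon> / 2 + \<epsilon> * \<epsilon> / 16" by (simp add: algebra_simps)
      ultimately show "(1 + \<epsilon> / 4) * (1 + \<epsilon> / 4) \<le> 1 + \<epsilon>" using assms(4) by linarith
      show "0 \<le> w * r" using assms by simp
    qed
    finally show ?thesis by (simp add: algebra_simps)
  qed
  show "w * v - (1 + w) * \<mu> + l * (1 + w)\<^sup>2 * c * \<mu> \<le> (1 + \<epsilon>) * r * w"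
  proof -
    have "0 \<le> w * \<mu>" using assms(1) mu0 by simp
    then have "w * v - (1 + w) * \<mu> + l * (1 + w)\<^sup>2 * c * \<mu> \<le>
        w * v - w * v * (1 - r - c) + 8 * (l * c) * (w * v)"
      using \<mu>(1) quad by (simp add: algebra_simps)
    also have "\<dots> = w * v * (r + (c + 8 * (l * c)))" by (simp add: algebra_simps)
    also have "\<dots> \<le> w * v * (r + \<epsilon> * r / 4)"
      using small' wv assms(1) by (intro mult_left_mono) auto
    finally show ?thesis using final by simp
  qed
  show "(1 + w) * \<mu> - w * v + l * (1 + w)\<^sup>2 * c * \<mu> \<le> (1 + \<epsilon>) * r * w"
  proof -
    \<comment> \<open>In this direction the cross term \<open>w * \<mu>\<close> has the unfavourable
      sign; it is quadratic in \<open>w\<close> and is paid for by the \<open>2 * w\<close> in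
      \<open>small\<close>.\<close>
    have "w * \<mu> \<le> w * (2 * (w * v))" using assms(1) mu2 by (rule mult_left_mono[rotated])
    then have "(1 + w) * \<mu> - w * v + l * (1 + w)\<^sup>2 * c * \<mu> \<le>
        w * v * (1 + r) + w * (2 * (w * v)) - w * v + 8 * (l * c) * (w * v)"
      using \<mu>(2) quad by (simp add: algebra_simps)
    also have "\<dots> = w * v * (r + (8 * (l * c) + 2 * w))" by (simp add: algebra_simps)
    also have "\<dots> \<le> w * v * (r + \<epsilon> * r / 4)"
      using small' wv assms(2) by (intro mult_left_mono) auto
    finally show ?thesis using final by simp
  qed
qed

subsection \<open>The potential\<close>

text \<open>The absolute value of the deviation is split into two exponentials, one per sign, so
  that each exponent is linear in the degree. The allowance is \<open>A * x powr a\<close>.\<close>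

definition potential ::
  "real \<Rightarrow> real \<Rightarrow> real \<Rightarrow> real \<Rightarrow> 'a set \<Rightarrow> 'a set set \<Rightarrow> real \<Rightarrow> real" where
  "potential l a A y E C x =
    (\<Sum>e\<in>E. exp (l * (x * hdeg C e / y - 1 - A * x powr a)) +
            exp (l * (1 - x * hdeg C e / y - A * x powr a)))"

text \<open>The supermartingale inequality for one removal from a balanced hypergraph. The quantity
  \<open>q * y\<close> bounds both the largest loss and the double-counting error; the growth of the
  allowance pays for drift and second moment.\<close>

lemma potential_step:
  fixes C :: "'a set set" and E :: "'a set" and A l q x y \<epsilon> :: real and m :: nat
  assumes finE: "finite E" and finC: "finite C" and ne: "C \<noteq> {}"
    and sub: "\<And>F. F \<in> C \<Longrightarrow> F \<subseteq> E" and unif: "\<And>F. F \<in> C \<Longrightarrow> card F = m" and m: "2 \<le> m"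
    and loss: "\<And>e F. e \<in> E \<Longrightarrow> F \<in> C \<Longrightarrow> real (hloss C e F) \<le> q * y"
    and overlap: "\<And>e D. D \<in> C \<Longrightarrow> e \<in> D \<Longrightarrow>
      (\<Sum>f\<in>D - {e}. real (hdeg C f)) \<le> card {F \<in> C. e \<notin> F \<and> F \<inter> D \<noteq> {}} + q * y"
    and pos: "0 < y" "0 < x" "0 < l" "0 \<le> q" "0 \<le> A" "0 < \<epsilon>" "\<epsilon> \<le> 1"
  defines "r \<equiv> A * x powr (1 + \<epsilon>)"
    and "w \<equiv> real (m - 1) * y / (card C * x)"
  assumes bal: "\<And>e. e \<in> E \<Longrightarrow> \<bar>x * hdeg C e / y - 1\<bar> \<le> r"
    and r_le: "r \<le> \<epsilon> / 4"
    and small: "q * x * (1 + 8 * l) + 2 * w \<le> \<epsilon> * r / 4"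
  shows "(\<Sum>F\<in>C. potential l (1 + \<epsilon>) A y (E - F) {D \<in> C. D \<inter> F = {}} (x * (1 + w))) / card C
    \<le> potential l (1 + \<epsilon>) A y E C x"
proof -
  define r' where "r' = A * (x * (1 + w)) powr (1 + \<epsilon>)"
  define v where "v e = x * hdeg C e / y" for e
  define \<nu> where "\<nu> e F = x * hloss C e F / y" for e F
  define \<mu> where "\<mu> e = (\<Sum>F\<in>C. \<nu> e F) / card C" for e
  define t where "t = l * (1 + w)"
  define c where "c = q * x"
  have Q: "real (card C) > 0" using finC ne by (simp add: card_gt_0_iff)
  have w0: "w \<ge> 0" using pos Q by (simp add: w_def)
  have r0: "r \<ge> 0" using pos by (simp add: r_def)
  have c0: "c \<ge> 0" using pos by (simp add: c_def)
  have rr: "r + (1 + \<epsilon>) * r * w \<le> r'"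
  proof -
    have "A * (x powr (1 + \<epsilon>) * (1 + (1 + \<epsilon>) * w)) \<le> r'"
      unfolding r'_def using pos w0 by (intro mult_left_mono powr_ge_tangent) auto
    then show ?thesis by (simp add: r_def algebra_simps)
  qed
  have bal': "\<bar>v e - 1\<bar> \<le> r" if "e \<in> E" for e
    using bal[OF that] by (simp add: v_def)
  have deg_le: "real (hdeg C e) \<le> (1 + r) * y / x" and deg_ge: "(1 - r) * y / x \<le> real (hdeg C e)"
    if "e \<in> E" for e
  proof -
    have "x * hdeg C e / y \<le> 1 + r" "1 - r \<le> x * hdeg C e / y"
      using bal[OF that] by linarith+
    then show "real (hdeg C e) \<le> (1 + r) * y / x" "(1 - r) * y / x \<le> real (hdeg C e)"
      using pos by (simp_all add: field_simps)
  qed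
  have tc: "t * c \<le> 1"
  proof -
    have er: "\<epsilon> * r \<le> 1 * (1 / 4)" using pos r_le r0 by (intro mult_mono) auto
    have "c * (1 + 8 * l) = c + 8 * (l * c)" by (simp add: algebra_simps)
    moreover have "0 \<le> l * c" using c0 pos by simp
    ultimately have "l * c \<le> 1/2" "w \<le> 1"
      using small er c0 w0 unfolding c_def[symmetric] by linarith+
    then have "(l * c) * (1 + w) \<le> 1/2 * 2" using c0 pos w0 by (intro mult_mono) auto
    then show ?thesis by (simp add: t_def algebra_simps)
  qed
  have \<nu>: "0 \<le> \<nu> e F \<and> \<nu> e F \<le> c" if "e \<in> E" "F \<in> C" for e F
  proof -
    have "x * hloss C e F \<le> x * (q * y)" using loss[OF that] pos by (intro mult_left_mono) auto
    then show ?thesis using pos by (simp add: \<nu>_def c_def field_simps)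
  qed
  \<comment> \<open>Each \<open>D\<close> through \<open>e\<close> is destroyed, with
    \<open>e\<close> spared, by about \<open>(m - 1) * y / x\<close> cliques: the union bound over
    \<open>D - {e}\<close> gives the upper estimate, \<open>overlap\<close> the lower one.\<close>
  have \<mu>: "w * v e * (1 - r - c) \<le> \<mu> e" "\<mu> e \<le> w * v e * (1 + r)" if e: "e \<in> E" for e
  proof -
    let ?N = "\<lambda>D. card {F \<in> C. e \<notin> F \<and> F \<inter> D \<noteq> {}}"
    have \<mu>_eq: "\<mu> e = x / y / card C * (\<Sum>D\<in>{D \<in> C. e \<in> D}. real (?N D))"
    proof -
      have "(\<Sum>F\<in>C. \<nu> e F) = x / y * real (\<Sum>F\<in>C. hloss C e F)"
        by (simp add: \<nu>_def sum_distrib_left)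
      then show ?thesis unfolding \<mu>_def sum_hloss[OF finC] by (simp add: field_simps)
    qed
    have cardD: "card (D - {e}) = m - 1" "D - {e} \<subseteq> E" "finite D" if "D \<in> C" "e \<in> D" for D
      using that sub[OF that(1)] unif[OF that(1)] finE finite_subset by auto
    have lower: "real (m - 1) * ((1 - r) * y / x) - q * y \<le> real (?N D)"
      if D: "D \<in> {D \<in> C. e \<in> D}" for D
    proof -
      have "real (m - 1) * ((1 - r) * y / x) = (\<Sum>f\<in>D - {e}. (1 - r) * y / x)"
        using cardD D by simp
      also have "\<dots> \<le> (\<Sum>f\<in>D - {e}. real (hdeg C f))"
        using cardD D by (intro sum_mono deg_ge) auto
      finally show ?thesis using overlap[of D e] D by simp
    qed
    have upper: "real (?N D) \<le> real (m - 1) * ((1 + r) * y / x)"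
      if D: "D \<in> {D \<in> C. e \<in> D}" for D
    proof -
      have fin: "finite (D - {e})" using cardD D by auto
      have "?N D = (\<Sum>F\<in>C. if e \<notin> F \<and> F \<inter> D \<noteq> {} then 1 else 0)"
        by (rule card_filter_eq_sum[OF finC])
      also have "\<dots> \<le> (\<Sum>F\<in>C. card (F \<inter> (D - {e})))"
      proof (rule sum_mono)
        fix F assume "F \<in> C"
        show "(if e \<notin> F \<and> F \<inter> D \<noteq> {} then 1 else 0) \<le> card (F \<inter> (D - {e}))"
          using fin by (auto simp: Suc_le_eq card_gt_0_iff)
      qed
      also have "\<dots> = (\<Sum>f\<in>D - {e}. hdeg C f)" using sum_hdeg[OF finC fin] by simp
      finally have "real (?N D) \<le> (\<Sum>f\<in>D - {e}. real (hdeg C f))"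
        by (simp flip: of_nat_sum)
      also have "\<dots> \<le> (\<Sum>f\<in>D - {e}. (1 + r) * y / x)"
        using cardD D by (intro sum_mono deg_le) auto
      also have "\<dots> = real (m - 1) * ((1 + r) * y / x)" using cardD D by simp
      finally show ?thesis .
    qed
    have S: "real (card {D \<in> C. e \<in> D}) = v e * y / x"
      using pos by (simp add: v_def hdeg_def)
    have k: "0 \<le> x / y / card C" using pos by simp
    have "v e * y / x * (real (m - 1) * ((1 - r) * y / x) - q * y) \<le>
        (\<Sum>D\<in>{D \<in> C. e \<in> D}. real (?N D))"
      using sum_mono[of "{D \<in> C. e \<in> D}" "\<lambda>_. real (m - 1) * ((1 - r) * y / x) - q * y"
          "\<lambda>D. real (?N D)"] lower S by simp
    from mult_left_mono[OF this k]
    have "v e / card C * (real (m - 1) * ((1 - r) * y / x) - q * y) \<le> \<mu> e"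
      unfolding \<mu>_eq using pos by simp
    moreover have "v e / card C * (real (m - 1) * ((1 - r) * y / x)) = w * v e * (1 - r)"
      by (simp add: w_def)
    moreover have "v e / card C * (q * y) \<le> w * v e * c"
    proof -
      have "v e / card C * (q * y) * 1 \<le> v e / card C * (q * y) * real (m - 1)"
        using m pos by (intro mult_left_mono) (auto simp: v_def)
      also have "\<dots> = w * v e * c" using pos by (simp add: w_def c_def)
      finally show ?thesis by simp
    qed
    ultimately show "w * v e * (1 - r - c) \<le> \<mu> e" by (simp add: right_diff_distrib)
    have "(\<Sum>D\<in>{D \<in> C. e \<in> D}. real (?N D)) \<le> v e * y / x * (real (m - 1) * ((1 + r) * y / x))"
      using sum_mono[of "{D \<in> C. e \<in> D}" "\<lambda>D. real (?N D)"
          "\<lambda>_. real (m - 1) * ((1 + r) * y / x)"] upper S by simp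
    from mult_left_mono[OF this k]
    have "\<mu> e \<le> v e / card C * (real (m - 1) * ((1 + r) * y / x))"
      unfolding \<mu>_eq using pos by simp
    also have "\<dots> = w * v e * (1 + r)" by (simp add: w_def)
    finally show "\<mu> e \<le> w * v e * (1 + r)" .
  qed
  \<comment> \<open>Upward deviations: the loss enters the exponent with factor \<open>- t\<close>,
    where \<open>t = l * (1 + w)\<close> because it is rescaled by the new clock. For downward
    deviations below, the factor is \<open>t\<close>.\<close>
  have up: "(\<Sum>F\<in>C. exp (l * ((1 + w) * (v e - \<nu> e F) - 1 - r'))) / card C
      \<le> exp (l * (v e - 1 - r))" if e: "e \<in> E" for e
  proof -
    have "(\<Sum>F\<in>C. exp (l * ((1 + w) * (v e - \<nu> e F) - 1 - r'))) =
        (\<Sum>F\<in>C. exp (l * ((1 + w) * v e - 1 - r')) * exp (- t * \<nu> e F))"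
      by (intro sum.cong refl) (simp add: t_def algebra_simps flip: exp_add)
    then have "(\<Sum>F\<in>C. exp (l * ((1 + w) * (v e - \<nu> e F) - 1 - r'))) / card C =
        exp (l * ((1 + w) * v e - 1 - r')) * ((\<Sum>F\<in>C. exp (- t * \<nu> e F)) / card C)"
      by (simp add: sum_distrib_left)
    also have "\<dots> \<le> exp (l * ((1 + w) * v e - 1 - r')) * exp (- t * \<mu> e + (- t)\<^sup>2 * c * \<mu> e)"
      unfolding \<mu>_def using \<nu>[OF e] finC ne tc pos w0
      by (intro mult_left_mono mean_exp_le) (auto simp: t_def)
    also have "\<dots> = exp (l * (v e - 1 - r' + (w * v e - (1 + w) * \<mu> e + l * (1 + w)\<^sup>2 * c * \<mu> e)))"
      by (simp add: t_def algebra_simps power2_eq_square flip: exp_add)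
    also have "\<dots> \<le> exp (l * (v e - 1 - r))"
      using drift_le(1)[OF w0 c0 pos(3,6,7) r0 r_le bal'[OF e] \<mu>[OF e]] small rr pos
      by (simp add: c_def)
    finally show ?thesis .
  qed
  have low: "(\<Sum>F\<in>C. exp (l * (1 - (1 + w) * (v e - \<nu> e F) - r'))) / card C
      \<le> exp (l * (1 - v e - r))" if e: "e \<in> E" for e
  proof -
    have "(\<Sum>F\<in>C. exp (l * (1 - (1 + w) * (v e - \<nu> e F) - r'))) =
        (\<Sum>F\<in>C. exp (l * (1 - (1 + w) * v e - r')) * exp (t * \<nu> e F))"
      by (intro sum.cong refl) (simp add: t_def algebra_simps flip: exp_add)
    then have "(\<Sum>F\<in>C. exp (l * (1 - (1 + w) * (v e - \<nu> e F) - r'))) / card C =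
        exp (l * (1 - (1 + w) * v e - r')) * ((\<Sum>F\<in>C. exp (t * \<nu> e F)) / card C)"
      by (simp add: sum_distrib_left)
    also have "\<dots> \<le> exp (l * (1 - (1 + w) * v e - r')) * exp (t * \<mu> e + t\<^sup>2 * c * \<mu> e)"
      unfolding \<mu>_def using \<nu>[OF e] finC ne tc pos w0
      by (intro mult_left_mono mean_exp_le) (auto simp: t_def)
    also have "\<dots> = exp (l * (1 - v e - r' + ((1 + w) * \<mu> e - w * v e + l * (1 + w)\<^sup>2 * c * \<mu> e)))"
      by (simp add: t_def algebra_simps power2_eq_square flip: exp_add)
    also have "\<dots> \<le> exp (l * (1 - v e - r))"
      using drift_le(2)[OF w0 c0 pos(3,6,7) r0 r_le bal'[OF e] \<mu>[OF e]] small rr pos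
      by (simp add: c_def)
    finally show ?thesis .
  qed
  define g where "g e F = exp (l * ((1 + w) * (v e - \<nu> e F) - 1 - r')) +
      exp (l * (1 - (1 + w) * (v e - \<nu> e F) - r'))" for e F
  have "potential l (1 + \<epsilon>) A y (E - F) {D \<in> C. D \<inter> F = {}} (x * (1 + w)) \<le> (\<Sum>e\<in>E. g e F)"
    if "F \<in> C" for F
  proof -
    have eq: "x * (1 + w) * hdeg {D \<in> C. D \<inter> F = {}} e / y = (1 + w) * (v e - \<nu> e F)"
      if "e \<in> E - F" for e
      using that finC by (simp add: hdeg_delete v_def \<nu>_def algebra_simps diff_divide_distrib)
    have "potential l (1 + \<epsilon>) A y (E - F) {D \<in> C. D \<inter> F = {}} (x * (1 + w)) = (\<Sum>e\<in>E - F. g e F)"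
      unfolding potential_def g_def r'_def[symmetric] by (intro sum.cong refl) (simp only: eq)
    \<comment> \<open>The removed edges are put back with nonnegative terms; the index set then no
      longer depends on \<open>F\<close> and the two sums can be exchanged.\<close>
    also have "\<dots> \<le> (\<Sum>e\<in>E. g e F)"
      using finE by (intro sum_mono2) (auto simp: g_def add_nonneg_nonneg)
    finally show ?thesis .
  qed
  then have "(\<Sum>F\<in>C. potential l (1 + \<epsilon>) A y (E - F) {D \<in> C. D \<inter> F = {}} (x * (1 + w)))
      \<le> (\<Sum>F\<in>C. \<Sum>e\<in>E. g e F)"
    by (rule sum_mono)
  also have "\<dots> = (\<Sum>e\<in>E. \<Sum>F\<in>C. g e F)" by (rule sum.swap)
  finally have "(\<Sum>F\<in>C. potential l (1 + \<epsilon>) A y (E - F) {D \<in> C. D \<inter> F = {}} (x * (1 + w))) / card C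
      \<le> (\<Sum>e\<in>E. \<Sum>F\<in>C. g e F) / card C"
    by (rule divide_right_mono) simp
  also have "\<dots> = (\<Sum>e\<in>E. (\<Sum>F\<in>C. g e F) / card C)" by (simp add: sum_divide_distrib)
  also have "\<dots> \<le> (\<Sum>e\<in>E. exp (l * (v e - 1 - r)) + exp (l * (1 - v e - r)))"
    using up low by (intro sum_mono) (simp add: g_def sum.distrib add_divide_distrib add_mono)
  also have "\<dots> = potential l (1 + \<epsilon>) A y E C x"
    unfolding potential_def v_def r_def ..
  finally show ?thesis .
qed


subsection \<open>Counting cliques\<close>

lemma card_nsets_supersets:
  assumes "finite A" "Z \<subseteq> A" "card Z \<le> k"
  shows "card {R \<in> [A]\<^bsup>k\<^esup>. Z \<subseteq> R} = (card A - card Z) choose (k - card Z)"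
proof -
  have Z: "finite Z" using assms finite_subset by blast
  have "bij_betw (\<lambda>R. R - Z) {R \<in> [A]\<^bsup>k\<^esup>. Z \<subseteq> R} {B. B \<subseteq> A - Z \<and> card B = k - card Z}"
  proof (rule bij_betw_byWitness[where f' = "\<lambda>B. B \<union> Z"])
    show "(\<lambda>B. B \<union> Z) ` {B. B \<subseteq> A - Z \<and> card B = k - card Z} \<subseteq> {R \<in> [A]\<^bsup>k\<^esup>. Z \<subseteq> R}"
    proof clarify
      fix B assume B: "B \<subseteq> A - Z" "card B = k - card Z"
      then have "finite B" using assms(1) finite_subset by blast
      moreover have "card (B \<union> Z) = card B + card Z"
        using B Z \<open>finite B\<close> by (intro card_Un_disjoint) auto
      ultimately show "B \<union> Z \<in> [A]\<^bsup>k\<^esup> \<and> Z \<subseteq> B \<union> Z"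
        using B Z assms by (auto simp: nsets_def)
    qed
    show "(\<lambda>R. R - Z) ` {R \<in> [A]\<^bsup>k\<^esup>. Z \<subseteq> R} \<subseteq> {B. B \<subseteq> A - Z \<and> card B = k - card Z}"
      using Z by (auto simp: nsets_def card_Diff_subset)
  qed auto
  then have "card {R \<in> [A]\<^bsup>k\<^esup>. Z \<subseteq> R} = card {B. B \<subseteq> A - Z \<and> card B = k - card Z}"
    by (rule bij_betw_same_card)
  also have "\<dots> = (card A - card Z) choose (k - card Z)"
    using assms Z by (simp add: n_subsets card_Diff_subset)
  finally show ?thesis .
qed

lemma card_nsets_finite: "finite A \<Longrightarrow> card ([A]\<^bsup>k\<^esup>) = card A choose k"
  using card_nsets_supersets[of A "{}" k] by simp

text \<open>The vertex set is recovered from the edge set, so copies of a clique can be counted by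
  their vertex sets.\<close>

lemma Union_nsets_2:
  assumes "2 \<le> card S"
  shows "\<Union> ([S]\<^bsup>2\<^esup>) = S"
proof (intro equalityI subsetI)
  fix x assume "x \<in> S"
  have "\<not> S \<subseteq> {x}" using assms card_mono[of "{x}" S] by auto
  then obtain y where "y \<in> S" "y \<noteq> x" by auto
  with \<open>x \<in> S\<close> have "{x, y} \<in> [S]\<^bsup>2\<^esup>" by simp
  then show "x \<in> \<Union> ([S]\<^bsup>2\<^esup>)" by (rule UnionI) simp
qed (auto simp: nsets_def)

lemma clique_copiesE:
  assumes "F \<in> clique_copies k n E"
  obtains S where "F = [S]\<^bsup>2\<^esup>" "S \<in> [{1..n}]\<^bsup>k\<^esup>" "[S]\<^bsup>2\<^esup> \<subseteq> E"
  using assms by (auto simp: clique_copies_def)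

lemma clique_copies_subset: "F \<in> clique_copies k n E \<Longrightarrow> F \<subseteq> E"
  by (auto simp: clique_copies_def)

lemma card_clique_copy: "F \<in> clique_copies k n E \<Longrightarrow> card F = k choose 2"
  by (auto simp: clique_copies_def card_nsets_finite) (auto simp: nsets_def card_nsets_finite)

lemma clique_copies_delete:
  "clique_copies k n (E - F) = {D \<in> clique_copies k n E. D \<inter> F = {}}"
  by (auto simp: clique_copies_def)

lemma mem_nsets_2_iff: "e \<in> [S]\<^bsup>2\<^esup> \<longleftrightarrow> e \<subseteq> S \<and> card e = 2"
  by (auto simp: nsets_def card_2_iff)

lemma hdeg_complete:
  assumes "2 \<le> k" "e \<in> [{1..n}]\<^bsup>2\<^esup>"
  shows "hdeg (clique_copies k n ([{1..n}]\<^bsup>2\<^esup>)) e = (n - 2) choose (k - 2)"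
proof -
  have e: "e \<subseteq> {1..n}" "card e = 2" using assms(2) by (auto simp: nsets_def)
  have "{D \<in> clique_copies k n ([{1..n}]\<^bsup>2\<^esup>). e \<in> D} = (\<lambda>S. [S]\<^bsup>2\<^esup>) ` {R \<in> [{1..n}]\<^bsup>k\<^esup>. e \<subseteq> R}"
  proof (intro equalityI subsetI)
    fix D assume "D \<in> (\<lambda>S. [S]\<^bsup>2\<^esup>) ` {R \<in> [{1..n}]\<^bsup>k\<^esup>. e \<subseteq> R}"
    then obtain R where R: "D = [R]\<^bsup>2\<^esup>" "R \<in> [{1..n}]\<^bsup>k\<^esup>" "e \<subseteq> R" by auto
    moreover from R(2) have "[R]\<^bsup>2\<^esup> \<subseteq> [{1..n}]\<^bsup>2\<^esup>" by (intro nsets_mono) (simp add: nsets_def)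
    ultimately show "D \<in> {D \<in> clique_copies k n ([{1..n}]\<^bsup>2\<^esup>). e \<in> D}"
      using e by (auto simp: clique_copies_def mem_nsets_2_iff)
  qed (auto simp: clique_copies_def mem_nsets_2_iff)
  moreover have "inj_on (\<lambda>S. [S]\<^bsup>2\<^esup>) {R \<in> [{1..n}]\<^bsup>k\<^esup>. e \<subseteq> R}"
  proof (rule inj_on_inverseI[where g = Union])
    fix R assume "R \<in> {R \<in> [{1..n}]\<^bsup>k\<^esup>. e \<subseteq> R}"
    then have "card R = k" by (simp add: nsets_def)
    then show "\<Union> ([R]\<^bsup>2\<^esup>) = R" using assms(1) by (intro Union_nsets_2) simp
  qed
  ultimately show ?thesis
    unfolding hdeg_def using card_nsets_supersets[of "{1..n}" e k] e assms(1)
    by (simp add: card_image)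
qed

text \<open>Union bound over the triples in \<open>I\<close>. The gain is that a triple lies in only
  a fraction of order \<open>1 / n\<close> of the initial degree of an edge, by
  \<open>binomial_3_le\<close>.\<close>

lemma card_cliques_meeting_le:
  assumes "3 \<le> k" and "\<And>D. D \<in> X \<Longrightarrow> D \<in> clique_copies k n E"
    and "finite I" "card I \<le> N" "\<And>Z. Z \<in> I \<Longrightarrow> Z \<subseteq> {1..n} \<and> card Z = 3"
    and "\<And>S. S \<in> [{1..n}]\<^bsup>k\<^esup> \<Longrightarrow> [S]\<^bsup>2\<^esup> \<in> X \<Longrightarrow> \<exists>Z\<in>I. Z \<subseteq> S"
  shows "card X \<le> N * ((n - 3) choose (k - 3))"
proof -
  have fin: "finite {R \<in> [{1..n}]\<^bsup>k\<^esup>. Z \<subseteq> R}" for Z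
    by (simp add: finite_imp_finite_nsets)
  have "X \<subseteq> (\<Union>Z\<in>I. (\<lambda>S. [S]\<^bsup>2\<^esup>) ` {R \<in> [{1..n}]\<^bsup>k\<^esup>. Z \<subseteq> R})"
  proof
    fix D assume "D \<in> X"
    then obtain S where S: "D = [S]\<^bsup>2\<^esup>" "S \<in> [{1..n}]\<^bsup>k\<^esup>"
      using assms(2) clique_copiesE by metis
    then show "D \<in> (\<Union>Z\<in>I. (\<lambda>S. [S]\<^bsup>2\<^esup>) ` {R \<in> [{1..n}]\<^bsup>k\<^esup>. Z \<subseteq> R})"
      using assms(6)[of S] \<open>D \<in> X\<close> by blast
  qed
  then have "card X \<le> card (\<Union>Z\<in>I. (\<lambda>S. [S]\<^bsup>2\<^esup>) ` {R \<in> [{1..n}]\<^bsup>k\<^esup>. Z \<subseteq> R})"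
    using fin assms(3) by (intro card_mono) auto
  also have "\<dots> \<le> (\<Sum>Z\<in>I. card ((\<lambda>S. [S]\<^bsup>2\<^esup>) ` {R \<in> [{1..n}]\<^bsup>k\<^esup>. Z \<subseteq> R}))"
    using assms(3) by (rule card_UN_le)
  also have "\<dots> \<le> (\<Sum>Z\<in>I. (n - 3) choose (k - 3))"
  proof (rule sum_mono)
    fix Z assume "Z \<in> I"
    then have "card {R \<in> [{1..n}]\<^bsup>k\<^esup>. Z \<subseteq> R} = (n - 3) choose (k - 3)"
      using card_nsets_supersets[of "{1..n}" Z k] assms(1,5) by simp
    then show "card ((\<lambda>S. [S]\<^bsup>2\<^esup>) ` {R \<in> [{1..n}]\<^bsup>k\<^esup>. Z \<subseteq> R}) \<le> (n - 3) choose (k - 3)"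
      using card_image_le[OF fin, of "\<lambda>S. [S]\<^bsup>2\<^esup>" Z] by simp
  qed
  also have "\<dots> \<le> N * ((n - 3) choose (k - 3))" using assms(4) by simp
  finally show ?thesis .
qed

text \<open>If \<open>e\<close> is not in \<open>F\<close>, a clique through \<open>e\<close> that
  shares an edge with \<open>F\<close> contains \<open>e\<close> together with a vertex of
  \<open>F\<close> outside \<open>e\<close>, hence one of at most \<open>k\<close> triples.\<close>

lemma hloss_clique_copies_le:
  assumes "3 \<le> k" "e \<in> [{1..n}]\<^bsup>2\<^esup>" "F \<in> clique_copies k n E"
  shows "hloss (clique_copies k n E) e F \<le> k * ((n - 3) choose (k - 3))"
proof (cases "e \<in> F")
  case False
  obtain S where S: "F = [S]\<^bsup>2\<^esup>" "S \<in> [{1..n}]\<^bsup>k\<^esup>" using assms(3) clique_copiesE by metis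
  have e: "e \<subseteq> {1..n}" "card e = 2" "finite e" using assms(2) by (auto simp: nsets_def)
  have S': "finite S" "card S = k" "S \<subseteq> {1..n}" using S by (auto simp: nsets_def)
  have "card {D \<in> clique_copies k n E. e \<in> D \<and> D \<inter> F \<noteq> {}} \<le> k * ((n - 3) choose (k - 3))"
  proof (rule card_cliques_meeting_le[OF assms(1), where E = E and I = "(\<lambda>x. insert x e) ` (S - e)"])
    show "card ((\<lambda>x. insert x e) ` (S - e)) \<le> k"
      using card_image_le[of "S - e" "\<lambda>x. insert x e"] card_mono[of S "S - e"] S' by auto
    show "\<exists>Z\<in>(\<lambda>x. insert x e) ` (S - e). Z \<subseteq> R"
      if R: "R \<in> [{1..n}]\<^bsup>k\<^esup>" "[R]\<^bsup>2\<^esup> \<in> {D \<in> clique_copies k n E. e \<in> D \<and> D \<inter> F \<noteq> {}}" for R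
    proof -
      from R S have eR: "e \<subseteq> R" and "[R]\<^bsup>2\<^esup> \<inter> [S]\<^bsup>2\<^esup> \<noteq> {}" by (auto simp: mem_nsets_2_iff)
      then obtain f where f: "f \<subseteq> R" "f \<subseteq> S" "card f = 2" by (auto simp: mem_nsets_2_iff)
      have "\<not> f \<subseteq> e"
      proof
        assume "f \<subseteq> e"
        then have "f = e" using f e by (intro card_subset_eq) auto
        with f e False S show False by (auto simp: mem_nsets_2_iff)
      qed
      then obtain x where "x \<in> f" "x \<notin> e" by auto
      with f eR show ?thesis by auto
    qed
  qed (use e S' in auto)
  with False show ?thesis by (simp add: hloss_def)
qed (simp add: hloss_def)

text \<open>
  Two cliques sharing at most one edge are counted correctly by the sum of degrees; the others share at
  least three vertices.
\<close>

lemma sum_hdeg_clique_copies_le: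
  assumes "3 \<le> k" "D \<in> clique_copies k n E" "e \<in> D"
  defines "C \<equiv> clique_copies k n E"
  shows "(\<Sum>f\<in>D - {e}. hdeg C f) \<le>
    card {F \<in> C. e \<notin> F \<and> F \<inter> D \<noteq> {}} + (k choose 2) * (k choose 3) * ((n - 3) choose (k - 3))"
proof -
  obtain R where R: "D = [R]\<^bsup>2\<^esup>" "R \<in> [{1..n}]\<^bsup>k\<^esup>" using assms(2) clique_copiesE by metis
  have R': "finite R" "card R = k" "R \<subseteq> {1..n}" using R by (auto simp: nsets_def)
  have finD: "finite D" using R R' by (simp add: finite_imp_finite_nsets)
  define X where "X = {F \<in> C. card (F \<inter> D) \<ge> 2}"
  have "card X \<le> (k choose 3) * ((n - 3) choose (k - 3))"
  proof (rule card_cliques_meeting_le[OF assms(1), where E = E and I = "[R]\<^bsup>3\<^esup>"])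
    show "\<exists>Z\<in>[R]\<^bsup>3\<^esup>. Z \<subseteq> S" if S: "S \<in> [{1..n}]\<^bsup>k\<^esup>" "[S]\<^bsup>2\<^esup> \<in> X" for S
    proof -
      have S': "finite S" using S by (auto simp: nsets_def)
      have "[S]\<^bsup>2\<^esup> \<inter> D = [S \<inter> R]\<^bsup>2\<^esup>" by (auto simp: R mem_nsets_2_iff)
      \<comment> \<open>The common edges of two cliques form the clique on their common vertices, so
        two common edges force three common vertices.\<close>
      then have "2 \<le> card (S \<inter> R) choose 2"
        using S S' by (simp add: X_def card_nsets_finite)
      moreover have "card (S \<inter> R) choose 2 \<le> 1" if "card (S \<inter> R) \<le> 2"
        using binomial_right_mono[OF that, of 2] by simp
      ultimately have "3 \<le> card (S \<inter> R)" by linarith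
      then obtain Z where "Z \<subseteq> S \<inter> R" "card Z = 3" "finite Z"
        by (rule obtain_subset_with_card_n)
      then show ?thesis by (auto simp: nsets_def)
    qed
    show "card ([R]\<^bsup>3\<^esup>) \<le> k choose 3" using R' by (simp add: card_nsets_finite)
    show "finite ([R]\<^bsup>3\<^esup>)" using R' by (simp add: finite_imp_finite_nsets)
  qed (use R' in \<open>auto simp: X_def C_def nsets_def\<close>)
  then have X: "(k choose 2) * card X \<le> (k choose 2) * ((k choose 3) * ((n - 3) choose (k - 3)))"
    by simp
  have finC: "finite C" by (simp add: C_def)
  have "(\<Sum>f\<in>D - {e}. hdeg C f) = (\<Sum>F\<in>C. card (F \<inter> (D - {e})))"
    using finC finD by (intro sum_hdeg) auto
  \<comment> \<open>A clique sharing at most one edge with \<open>D\<close> counts 1 exactly if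
    there is such an edge and it is not \<open>e\<close>; one sharing more is charged
    \<open>k choose 2\<close>, the size of \<open>D\<close>.\<close>
  also have "\<dots> \<le> (\<Sum>F\<in>C. (if e \<notin> F \<and> F \<inter> D \<noteq> {} then 1 else 0) +
      (k choose 2) * (if card (F \<inter> D) \<ge> 2 then 1 else 0))"
  proof (rule sum_mono)
    fix F assume F: "F \<in> C"
    show "card (F \<inter> (D - {e})) \<le> (if e \<notin> F \<and> F \<inter> D \<noteq> {} then 1 else 0) +
        (k choose 2) * (if card (F \<inter> D) \<ge> 2 then 1 else 0)"
    proof (cases "card (F \<inter> D) \<ge> 2")
      case True
      have "card (F \<inter> (D - {e})) \<le> card D" using finD by (intro card_mono) auto
      also have "card D = k choose 2" using card_clique_copy[OF assms(2)] .
      finally show ?thesis using True by simp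
    next
      case False
      have le: "card (F \<inter> (D - {e})) \<le> card (F \<inter> D)" using finD by (intro card_mono) auto
      show ?thesis
      proof (cases "e \<in> F \<or> F \<inter> D = {}")
        case True
        have "card (F \<inter> (D - {e})) < card (F \<inter> D)" if "e \<in> F"
          using that finD assms(3) by (intro psubset_card_mono) auto
        then show ?thesis using False True le by (auto simp: not_le)
      qed (use False le in auto)
    qed
  qed
  also have "\<dots> = card {F \<in> C. e \<notin> F \<and> F \<inter> D \<noteq> {}} + (k choose 2) * card X"
    unfolding X_def card_filter_eq_sum[OF finC] by (simp add: sum.distrib sum_distrib_left)
  finally show ?thesis using X unfolding mult.assoc by linarith
qed

text \<open>Absorption relates the two binomials by the factor \<open>(k - 2) / (n - 2)\<close>, and
  \<open>n \<le> 3 * (n - 2)\<close> for \<open>3 \<le> n\<close>.\<close>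

lemma binomial_3_le:
  assumes "3 \<le> k" "3 \<le> n"
  shows "real ((n - 3) choose (k - 3)) \<le> 3 * real k / n * ((n - 2) choose (k - 2))"
proof -
  have "Suc (k - 3) * ((n - 2) choose Suc (k - 3)) = (n - 2) * (n - 2 - 1 choose (k - 3))"
    by (rule binomial_absorption)
  moreover have "Suc (k - 3) = k - 2" "n - 2 - 1 = n - 3" using assms by auto
  ultimately have "(k - 2) * ((n - 2) choose (k - 2)) = (n - 2) * ((n - 3) choose (k - 3))"
    by simp
  then have "real (n - 2) * real ((n - 3) choose (k - 3)) = real (k - 2) * real ((n - 2) choose (k - 2))"
    by (metis of_nat_mult)
  moreover have "real n * real ((n - 3) choose (k - 3)) \<le> 3 * real (n - 2) * real ((n - 3) choose (k - 3))"
    using assms by (intro mult_right_mono) auto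
  ultimately have "real n * real ((n - 3) choose (k - 3)) \<le> 3 * (real (k - 2) * real ((n - 2) choose (k - 2)))"
    by simp
  also have "\<dots> \<le> 3 * (real k * real ((n - 2) choose (k - 2)))"
    by (intro mult_left_mono mult_right_mono) auto
  finally show ?thesis using assms by (simp add: field_simps)
qed


subsection \<open>The law of the final graph\<close>

text \<open>Only the last graph matters for the bound; forgetting the rest of the trajectory leaves
  a recursion over the removed clique.\<close>

definition final_law :: "nat \<Rightarrow> nat \<Rightarrow> edges \<Rightarrow> edges pmf" where
  "final_law k n E = map_pmf last (removal_process k n E)"

lemma final_law_clique_free: "clique_free k n E \<Longrightarrow> final_law k n E = return_pmf E"
  by (simp add: final_law_def removal_process.simps)

lemma final_law_bind:
  assumes "2 \<le> k" "\<not> clique_free k n E"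
  shows "final_law k n E =
    bind_pmf (pmf_of_set (clique_copies k n E)) (\<lambda>F. final_law k n (E - F))"
proof -
  \<comment> \<open>Prepending \<open>E\<close> keeps the last entry because trajectories are
    non-empty.\<close>
  have "map_pmf last (map_pmf ((#) E) (removal_process k n E')) = final_law k n E'" for E'
    unfolding final_law_def map_pmf_comp
    by (rule map_pmf_cong) (use removal_process_support(1)[OF assms(1)] in auto)
  then show ?thesis
    using assms by (subst final_law_def, subst removal_process.simps)
      (simp add: map_bind_pmf removal_step_def bind_map_pmf)
qed

lemma set_final_law_subset:
  assumes "2 \<le> k" "E' \<in> set_pmf (final_law k n E)"
  shows "E' \<subseteq> E"
  using assms
proof (induction k n E rule: removal_process.induct)
  case (1 k n E)
  show ?case
  proof (cases "clique_free k n E")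
    case True
    with 1 show ?thesis by (simp add: final_law_clique_free)
  next
    case False
    then have "clique_copies k n E \<noteq> {}" by (simp add: clique_free_def)
    with 1(2,3) False obtain F where "F \<in> clique_copies k n E" "E' \<in> set_pmf (final_law k n (E - F))"
      by (auto simp: final_law_bind)
    then show ?thesis
      using 1(1)[of "E - F"] 1(2) False \<open>clique_copies k n E \<noteq> {}\<close> by (auto simp: removal_step_def)
  qed
qed

lemma prob_final_law_step:
  assumes "2 \<le> k" "\<not> clique_free k n E"
  shows "measure_pmf.prob (final_law k n E) X =
    (\<Sum>F\<in>clique_copies k n E. measure_pmf.prob (final_law k n (E - F)) X) / card (clique_copies k n E)"
proof -
  let ?p = "pmf_of_set (clique_copies k n E)"
  have "measure_pmf.prob (bind_pmf ?p (\<lambda>F. final_law k n (E - F))) X =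
      measure_pmf.expectation ?p (\<lambda>F. measure_pmf.prob (final_law k n (E - F)) X)"
    unfolding measure_pmf_bind
    using measurable_measure_pmf[of "\<lambda>F. final_law k n (E - F)"]
    by (intro measure_pmf.measure_bind[where N = "count_space UNIV"]) simp_all
  then show ?thesis
    using assms by (simp add: final_law_bind integral_pmf_of_set clique_free_def)
qed

text \<open>On every possible trajectory the hitting time is the index of the last entry, so the two
  events agree almost surely.\<close>

lemma prob_hitting_time_eq_final_law:
  assumes "2 \<le> k"
  shows "measure_pmf.prob (removal_process k n E) {G. P (G ! hitting_time k n G)} =
    measure_pmf.prob (final_law k n E) {E'. P E'}"
proof -
  have last: "G ! hitting_time k n G = last G" if "G \<in> set_pmf (removal_process k n E)" for G
  proof -
    have "length G = Suc (hitting_time k n G)" "G \<noteq> []"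
      using hitting_time_removal_process[OF assms that] removal_process_support(1)[OF assms that]
      by simp_all
    then show ?thesis by (simp add: last_conv_nth)
  qed
  show ?thesis
    unfolding final_law_def measure_map_pmf
  proof (rule measure_pmf.finite_measure_eq_AE)
    show "AE G in measure_pmf (removal_process k n E).
        (G \<in> {G. P (G ! hitting_time k n G)}) = (G \<in> last -` {E'. P E'})"
      using last by (simp add: AE_measure_pmf_iff)
  qed simp_all
qed

section \<open>The supermartingale induction along the process\<close>

text \<open>Keeps \<open>|E| * x powr \<beta>\<close> non-increasing when the clock \<open>x\<close> advances to \<open>x * (1 + w)\<close>.\<close>

lemma edge_decay:
  fixes N m w \<epsilon> \<beta> :: real
  assumes "0 < N" "1 < m" "0 \<le> w" "w \<le> (m - 1) * m / (N * (1 - \<epsilon> / 4))" "0 < \<epsilon>" "\<epsilon> < 1"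
    and \<beta>: "\<beta> = (1 - \<epsilon>) / (m - 1)"
  shows "(N - m) * (1 + w) powr \<beta> \<le> N"
proof -
  have "\<beta> \<ge> 0" using assms by simp
  have "\<beta> * w \<le> \<beta> * ((m - 1) * m / (N * (1 - \<epsilon> / 4)))"
    using assms(4) \<open>\<beta> \<ge> 0\<close> by (rule mult_left_mono)
  also have "\<dots> = (1 - \<epsilon>) / (1 - \<epsilon> / 4) * (m / N)"
    using \<open>1 < m\<close> unfolding \<beta> by simp
  \<comment> \<open>The factor \<open>1 - \<epsilon>\<close> in \<open>\<beta>\<close> outweighs the
    \<open>1 - \<epsilon> / 4\<close> in the denominator of the bound on \<open>w\<close>.\<close>
  also have "\<dots> \<le> 1 * (m / N)"
    using assms by (intro mult_right_mono) (auto simp: field_simps)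
  finally have w: "\<beta> * w \<le> m / N" by simp
  have "(1 + w) powr \<beta> = exp (\<beta> * ln (1 + w))" using assms(3) by (simp add: powr_def)
  also have "\<dots> \<le> exp (m / N)"
    using mult_left_mono[OF ln_add_one_self_le_self[OF assms(3)] \<open>\<beta> \<ge> 0\<close>] w by simp
  finally have p: "(1 + w) powr \<beta> \<le> exp (m / N)" .
  show ?thesis
  proof (cases "N \<le> m")
    case True
    then have "(N - m) * (1 + w) powr \<beta> \<le> 0" by (intro mult_nonpos_nonneg) auto
    then show ?thesis using assms(1) by simp
  next
    case False
    have "1 - m / N \<le> exp (- (m / N))" using exp_ge_add_one_self[of "- (m / N)"] by simp
    then have "N * (1 - m / N) \<le> N * exp (- (m / N))" using assms(1) by (intro mult_left_mono) auto
    then have "N - m \<le> N * exp (- (m / N))" using assms(1) by (simp add: right_diff_distrib)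
    then have "(N - m) * (1 + w) powr \<beta> \<le> N * exp (- (m / N)) * exp (m / N)"
      using p assms(1) by (intro mult_mono) auto
    then show ?thesis by (simp add: mult.assoc mult_exp_exp)
  qed
qed

text \<open>
  The errors \<open>k * g\<close> in the loss and \<open>(k choose 2) * (k choose 3) * g\<close> in the overlap count, where
  \<open>g = (n - 3) choose (k - 3)\<close>, are both at most \<open>clique_const k / n\<close> times the initial degree, since
  \<open>g \<le> 3 k / n\<close> times that degree.
\<close>

definition clique_const :: "nat \<Rightarrow> real" where
  "clique_const k = 3 * real k * (real k + real (k choose 2) * real (k choose 3))"

lemma clique_const_pos: "3 \<le> k \<Longrightarrow> 0 < clique_const k"
  by (simp add: clique_const_def add_pos_nonneg)

text \<open>Strong induction on the number of edges takes the place of a stopping time. The claim is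
  immediate once at most \<open>T\<close> edges remain or the potential is at least 1; otherwise all
  degrees are balanced and \<open>potential_step\<close> applies. While more than \<open>T\<close>
  edges remain, \<open>inv\<close> limits the clock and \<open>rho\<close> then limits the
  allowance.\<close>

lemma prob_final_large_le_potential:
  fixes k n :: nat and A l \<epsilon> T K x :: real
  assumes k: "3 \<le> k" and n: "k \<le> n"
    and pos: "0 < A" "0 < l" "0 < \<epsilon>" "\<epsilon> < 1" "0 < T"
  defines "m \<equiv> k choose 2" and "y \<equiv> real ((n - 2) choose (k - 2))"
  defines "\<beta> \<equiv> (1 - \<epsilon>) / (real m - 1)"
  assumes rho: "\<And>z. 1 \<le> z \<Longrightarrow> T * z powr \<beta> \<le> K \<Longrightarrow> A * z powr (1 + \<epsilon>) \<le> \<epsilon> / 4"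
    and small_l: "clique_const k / n * (1 + 8 * l) \<le> \<epsilon> * A / 8"
    and small_T: "4 * (real m)\<^sup>2 / T \<le> \<epsilon> * A / 8"
    and E: "E \<subseteq> [{1..n}]\<^bsup>2\<^esup>" and x: "1 \<le> x" and inv: "card E * x powr \<beta> \<le> K"
  shows "measure_pmf.prob (final_law k n E) {E'. T < real (card E')} \<le>
    potential l (1 + \<epsilon>) A y E (clique_copies k n E) x"
  using E x inv
proof (induction "card E" arbitrary: E x rule: less_induct)
  case less
  note E = less.prems(1) and x = less.prems(2) and inv = less.prems(3)
  let ?C = "clique_copies k n E"
  have finE: "finite E" using E by (rule finite_subset) (simp add: finite_imp_finite_nsets)
  have k2: "2 \<le> k" using k by simp
  have y: "0 < y" using k n by (simp add: y_def)
  have m3: "3 \<le> m" using binomial_right_mono[OF k, of 2] by (simp add: m_def choose_two)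
  have pot0: "0 \<le> potential l (1 + \<epsilon>) A y E ?C x"
    unfolding potential_def by (intro sum_nonneg) (simp add: add_nonneg_nonneg)
  consider "real (card E) \<le> T" | "1 \<le> potential l (1 + \<epsilon>) A y E ?C x"
    | "T < real (card E)" "potential l (1 + \<epsilon>) A y E ?C x < 1" by linarith
  then show ?case
  proof cases
    case 1
    have "measure_pmf.prob (final_law k n E) {E'. T < real (card E')} = 0"
    proof -
      have "\<not> T < real (card E')" if "E' \<in> set_pmf (final_law k n E)" for E'
        using card_mono[OF finE set_final_law_subset[OF k2 that]] 1 by linarith
      then show ?thesis by (auto simp: measure_pmf_zero_iff)
    qed
    with pot0 show ?thesis by simp
  next
    case 2
    then show ?thesis using measure_pmf.prob_le_1 order_trans by blast
  next
    case 3
    define r where "r = A * x powr (1 + \<epsilon>)"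
    have N0: "0 < real (card E)" using 3(1) pos by simp
    have "T * x powr \<beta> \<le> card E * x powr \<beta>" using 3(1) by (intro mult_right_mono) auto
    then have r_le: "r \<le> \<epsilon> / 4" using rho[OF x] inv by (simp add: r_def)
    have "x \<le> x powr (1 + \<epsilon>)" using x pos powr_mono[of 1 "1 + \<epsilon>" x] by simp
    then have Ax: "A * x \<le> r" unfolding r_def using pos by (intro mult_left_mono) auto
    have "A * 1 \<le> A * x" using x pos by (intro mult_left_mono) auto
    with Ax have Ar: "A \<le> r" by simp
    have bal: "\<bar>x * hdeg ?C e / y - 1\<bar> \<le> r" if e: "e \<in> E" for e
    proof -
      let ?a = "l * (x * hdeg ?C e / y - 1 - r)" and ?b = "l * (1 - x * hdeg ?C e / y - r)"
      have "exp ?a + exp ?b \<le> potential l (1 + \<epsilon>) A y E ?C x"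
        unfolding potential_def r_def using finE e
        by (intro member_le_sum) (auto simp: add_nonneg_nonneg)
      \<comment> \<open>Each exponential is bounded by the whole potential, hence below 1, so both
        exponents are negative.\<close>
      with 3(2) have "exp ?a < 1" "exp ?b < 1" using exp_gt_zero[of ?a] exp_gt_zero[of ?b] by linarith+
      then show ?thesis using pos by (auto simp: mult_less_0_iff)
    qed
    have deg_ge: "(1 - r) * y / x \<le> real (hdeg ?C e)" if "e \<in> E" for e
    proof -
      have "1 - r \<le> x * hdeg ?C e / y" using bal[OF that] by linarith
      then show ?thesis using x y by (simp add: field_simps)
    qed
    \<comment> \<open>Counting incidences bounds the number of cliques from below. This gives both
      the existence of a clique and the upper bound on \<open>w\<close>.\<close>
    have edges: "card E * ((1 - r) * y / x) \<le> m * real (card ?C)"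
    proof -
      have "card E * ((1 - r) * y / x) = (\<Sum>e\<in>E. (1 - r) * y / x)" by simp
      also have "\<dots> \<le> (\<Sum>e\<in>E. real (hdeg ?C e))" by (intro sum_mono deg_ge)
      also have "\<dots> = real (\<Sum>F\<in>?C. card (F \<inter> E))"
        by (simp only: sum_hdeg[OF finite_clique_copies finE] flip: of_nat_sum)
      also have "(\<Sum>F\<in>?C. card (F \<inter> E)) = (\<Sum>F\<in>?C. m)"
        by (intro sum.cong refl) (simp add: Int_absorb2 clique_copies_subset card_clique_copy m_def)
      finally show ?thesis by (simp add: mult.commute)
    qed
    have "0 < card E * ((1 - r) * y / x)"
      using N0 r_le pos y x by (intro mult_pos_pos divide_pos_pos) auto
    with edges have "0 < card ?C" by (auto intro: Nat.gr0I)
    then have ne: "?C \<noteq> {}" and Q: "0 < real (card ?C)" by auto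
    define w where "w = real (m - 1) * y / (card ?C * x)"
    have w0: "0 \<le> w" using y x by (simp add: w_def)
    have w_le: "w \<le> (real m - 1) * m / (card E * (1 - \<epsilon> / 4))"
    proof -
      have "card E * (1 - \<epsilon> / 4) * (y / x) \<le> card E * (1 - r) * (y / x)"
        using r_le x y by (intro mult_right_mono mult_left_mono) auto
      also have "\<dots> \<le> m * real (card ?C)" using edges by simp
      finally have "y * (card E * (1 - \<epsilon> / 4)) \<le> m * (real (card ?C) * x)"
        using x by (simp add: field_simps)
      then have "y / (card ?C * x) \<le> m / (card E * (1 - \<epsilon> / 4))"
        using x Q N0 pos by (simp add: divide_le_eq le_divide_eq)
      then have "(real m - 1) * (y / (card ?C * x)) \<le> (real m - 1) * (m / (card E * (1 - \<epsilon> / 4)))"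
        using m3 by (intro mult_left_mono) auto
      then show ?thesis using m3 by (simp add: w_def of_nat_diff)
    qed
    have w_T: "2 * w \<le> 4 * (real m)\<^sup>2 / T"
    proof -
      have "T * (1/2) \<le> card E * (1 - \<epsilon> / 4)" using 3(1) pos by (intro mult_mono) auto
      then have "(real m - 1) * m / (card E * (1 - \<epsilon> / 4)) \<le> (real m * m) / (T * (1/2))"
        using pos m3 by (intro frac_le mult_right_mono) auto
      with w_le show ?thesis by (simp add: power2_eq_square)
    qed
    define q where "q = clique_const k / n"
    have g: "real ((n - 3) choose (k - 3)) \<le> 3 * real k / n * y"
      unfolding y_def using k n by (intro binomial_3_le) auto
    have qy: "q * y = (real k + real (k choose 2) * real (k choose 3)) * (3 * real k / n * y)"
      by (simp add: q_def clique_const_def)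
    have loss: "real (hloss ?C e F) \<le> q * y" if "e \<in> E" "F \<in> ?C" for e F
    proof -
      have "real (hloss ?C e F) \<le> real k * real ((n - 3) choose (k - 3))"
        using hloss_clique_copies_le[OF k _ that(2), of e] that(1) E
        by (metis of_nat_le_iff of_nat_mult subsetD)
      also have "\<dots> \<le> (real k + real (k choose 2) * real (k choose 3)) * (3 * real k / n * y)"
        using g by (intro mult_mono) auto
      finally show ?thesis unfolding qy .
    qed
    have overlap: "(\<Sum>f\<in>D - {e}. real (hdeg ?C f)) \<le> card {F \<in> ?C. e \<notin> F \<and> F \<inter> D \<noteq> {}} + q * y"
      if "D \<in> ?C" "e \<in> D" for e D
    proof -
      have "real ((k choose 2) * (k choose 3) * ((n - 3) choose (k - 3))) =
          real (k choose 2) * real (k choose 3) * real ((n - 3) choose (k - 3))" by simp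
      also have "\<dots> \<le> (real k + real (k choose 2) * real (k choose 3)) * (3 * real k / n * y)"
        using g by (intro mult_mono) auto
      finally show ?thesis
        using of_nat_mono[OF sum_hdeg_clique_copies_le[OF k that], where ?'a = real]
        unfolding qy by simp
    qed
    have q0: "0 \<le> q" using clique_const_pos[OF k] by (simp add: q_def)
    \<comment> \<open>Half of the budget pays for the loss terms, which grow with \<open>x\<close>
      but no faster than \<open>r\<close>; the other half pays for the clock increment.\<close>
    have small: "q * x * (1 + 8 * l) + 2 * w \<le> \<epsilon> * r / 4"
    proof -
      have "x * (q * (1 + 8 * l)) \<le> x * (\<epsilon> * A / 8)"
        using small_l x unfolding q_def by (intro mult_left_mono) auto
      also have "\<dots> \<le> \<epsilon> * r / 8" using Ax pos by (simp add: mult.commute mult.left_commute)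
      finally have "q * x * (1 + 8 * l) \<le> \<epsilon> * r / 8" by (simp add: algebra_simps)
      moreover have "\<epsilon> * A / 8 \<le> \<epsilon> * r / 8" using Ar pos by simp
      ultimately show ?thesis using w_T small_T by simp
    qed
    have step: "(\<Sum>F\<in>?C. potential l (1 + \<epsilon>) A y (E - F) {D \<in> ?C. D \<inter> F = {}} (x * (1 + w))) / card ?C
        \<le> potential l (1 + \<epsilon>) A y E ?C x"
      unfolding w_def
    proof (rule potential_step[where m = m and q = q])
      show "2 \<le> m" using m3 by simp
      show "card F = m" if "F \<in> ?C" for F using card_clique_copy[OF that] by (simp add: m_def)
    qed (use finE ne clique_copies_subset loss overlap y x pos q0 bal r_le small
          in \<open>auto simp: r_def w_def\<close>)
    have IH: "measure_pmf.prob (final_law k n (E - F)) {E'. T < real (card E')} \<le>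
        potential l (1 + \<epsilon>) A y (E - F) {D \<in> ?C. D \<inter> F = {}} (x * (1 + w))" if F: "F \<in> ?C" for F
    proof -
      have FE: "F \<subseteq> E" and cF: "card F = m"
        using clique_copies_subset[OF F] card_clique_copy[OF F] by (auto simp: m_def)
      then have mE: "m \<le> card E" using card_mono[OF finE] by metis
      have cEF: "card (E - F) = card E - m"
        using FE finE cF by (simp add: card_Diff_subset finite_subset)
      have "real (card (E - F)) * (x * (1 + w)) powr \<beta> =
          (real (card E) - m) * (1 + w) powr \<beta> * x powr \<beta>"
        using x w0 cEF mE by (simp add: powr_mult of_nat_diff)
      also have "\<dots> \<le> card E * x powr \<beta>"
        using edge_decay[OF N0 _ w0 w_le pos(3,4) \<beta>_def[THEN meta_eq_to_obj_eq]] m3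
        by (intro mult_right_mono) auto
      finally have "card (E - F) * (x * (1 + w)) powr \<beta> \<le> K" using inv by simp
      moreover have "1 \<le> x * (1 + w)" using mult_mono[of 1 x 1 "1 + w"] x w0 by simp
      moreover have "card (E - F) < card E" using cEF mE m3 by simp
      moreover have "E - F \<subseteq> [{1..n}]\<^bsup>2\<^esup>" using E by auto
      ultimately show ?thesis using less.hyps[of "E - F"] by (simp add: clique_copies_delete)
    qed
    have "measure_pmf.prob (final_law k n E) {E'. T < real (card E')} =
        (\<Sum>F\<in>?C. measure_pmf.prob (final_law k n (E - F)) {E'. T < real (card E')}) / card ?C"
      using ne by (intro prob_final_law_step[OF k2]) (simp add: clique_free_def)
    also have "\<dots> \<le> (\<Sum>F\<in>?C. potential l (1 + \<epsilon>) A y (E - F) {D \<in> ?C. D \<inter> F = {}} (x * (1 + w))) / card ?C"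
      using IH by (intro divide_right_mono sum_mono) auto
    finally show ?thesis using step by simp
  qed
qed


subsection \<open>Choice of the parameters\<close>

lemma real_choose_two: "real (k choose 2) = real k * (real k - 1) / 2"
proof -
  have "even (k * (k - 1))" by (cases k) auto
  then have "real (k * (k - 1) div 2) = real (k * (k - 1)) / 2" by (simp add: real_of_nat_div)
  then show ?thesis by (cases k) (simp_all add: choose_two algebra_simps)
qed

text \<open>At clock 1 every degree has its initial value, so each edge contributes exactly
  \<open>2 * exp (- (l * A))\<close>.\<close>

lemma potential_complete:
  fixes k n :: nat and l a A :: real
  assumes "2 \<le> k" "k \<le> n" "0 < A"
  shows "potential l a A (real ((n - 2) choose (k - 2))) ([{1..n}]\<^bsup>2\<^esup>)
    (clique_copies k n ([{1..n}]\<^bsup>2\<^esup>)) 1 \<le> real n ^ 2 * exp (- (l * A))"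
proof -
  have "(n - 2) choose (k - 2) \<noteq> 0" using assms by simp
  then have "potential l a A (real ((n - 2) choose (k - 2))) ([{1..n}]\<^bsup>2\<^esup>)
    (clique_copies k n ([{1..n}]\<^bsup>2\<^esup>)) 1 = (\<Sum>e\<in>[{1..n}]\<^bsup>2\<^esup>. 2 * exp (- (l * A)))"
    unfolding potential_def using hdeg_complete[OF assms(1)] by (intro sum.cong refl) simp
  also have "\<dots> = 2 * real (n choose 2) * exp (- (l * A))"
    by (simp add: card_nsets_finite)
  also have "\<dots> \<le> real n ^ 2 * exp (- (l * A))"
    by (intro mult_right_mono) (simp_all add: real_choose_two power2_eq_square algebra_simps)
  finally show ?thesis .
qed

lemma prob_final_large_le:
  fixes k n :: nat and \<epsilon> :: real
  assumes k: "3 \<le> k" and n: "k \<le> n" and eps: "0 < \<epsilon>" "\<epsilon> < 1/4"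
  defines "m \<equiv> k choose 2"
  defines "\<beta> \<equiv> (1 - \<epsilon>) / (real m - 1)"
  assumes c1: "real n powr (- \<epsilon> / 2) \<le> \<epsilon> / 4"
    and c2: "clique_const k / n \<le> \<epsilon> * real n powr (- 1/2 + \<epsilon>) / 16"
    and c3: "4 * (real m)\<^sup>2 / real n powr (3/2) \<le> \<epsilon> * real n powr (- 1/2 + \<epsilon>) / 8"
  shows "measure_pmf.prob (final_law k n ([{1..n}]\<^bsup>2\<^esup>))
      {E. real n powr (2 - (1/2 - 2 * \<epsilon>) * \<beta>) < real (card E)}
    \<le> real n ^ 2 * exp (- (\<epsilon> / (128 * clique_const k) * real n powr (2 * \<epsilon>)))"
proof -
  define A where "A = real n powr (- 1/2 + \<epsilon>)"
  \<comment> \<open>With this \<open>l\<close> the term \<open>clique_const k / n * 8 * l\<close> is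
    \<open>\<epsilon> * A / 16\<close>, half of what the smallness condition allows;
    \<open>c2\<close> takes the other half.\<close>
  define l where "l = \<epsilon> * A * n / (128 * clique_const k)"
  define \<gamma> where "\<gamma> = 1/2 - 2 * \<epsilon>"
  \<comment> \<open>Chosen so that \<open>T * n powr (\<gamma> * \<beta>) = n ^ 2\<close>: with more
    than \<open>T\<close> edges left, the invariant keeps the clock at most
    \<open>n powr \<gamma>\<close>.\<close>
  define T where "T = real n powr (2 - \<gamma> * \<beta>)"
  have n0: "0 < real n" and n1: "1 \<le> real n" using k n by auto
  have b: "0 < clique_const k" using clique_const_pos[OF k] .
  have m3: "3 \<le> m" using binomial_right_mono[OF k, of 2] by (simp add: m_def choose_two)
  have \<gamma>: "0 < \<gamma>" "\<gamma> \<le> 1/2" using eps by (auto simp: \<gamma>_def)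
  have \<beta>: "0 < \<beta>" "\<beta> \<le> 1" using eps m3 by (auto simp: \<beta>_def)
  have A0: "0 < A" using n0 by (simp add: A_def)
  have l0: "0 < l" using eps A0 n0 b by (simp add: l_def)
  have "measure_pmf.prob (final_law k n ([{1..n}]\<^bsup>2\<^esup>)) {E'. T < real (card E')} \<le>
      potential l (1 + \<epsilon>) A (real ((n - 2) choose (k - 2))) ([{1..n}]\<^bsup>2\<^esup>)
        (clique_copies k n ([{1..n}]\<^bsup>2\<^esup>)) 1"
  proof (rule prob_final_large_le_potential[where K = "real n ^ 2"])
    fix z :: real assume z: "1 \<le> z" "T * z powr ((1 - \<epsilon>) / (real (k choose 2) - 1)) \<le> real n ^ 2"
    have "real n ^ 2 = T * real n powr (\<gamma> * \<beta>)"
      using n0 by (simp add: T_def flip: powr_add)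
    with z(2) have "z powr \<beta> \<le> (real n powr \<gamma>) powr \<beta>"
      using n0 by (simp add: T_def \<beta>_def m_def powr_powr)
    then have "z \<le> real n powr \<gamma>"
      using powr_less_mono2[OF \<beta>(1), of "real n powr \<gamma>" z] by fastforce
    then have "z powr (1 + \<epsilon>) \<le> (real n powr \<gamma>) powr (1 + \<epsilon>)"
      using z(1) eps by (intro powr_mono2) auto
    then have "A * z powr (1 + \<epsilon>) \<le> A * (real n powr \<gamma>) powr (1 + \<epsilon>)"
      using A0 by (intro mult_left_mono) auto
    also have "\<dots> = real n powr (- 1/2 + \<epsilon> + \<gamma> * (1 + \<epsilon>))"
      by (simp add: A_def powr_powr powr_add distrib_left)
    \<comment> \<open>The exponent is negative thanks to the \<open>2 * \<epsilon>\<close>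
      subtracted in \<open>\<gamma>\<close>, so the allowance tends to 0 even at the last clock
      time.\<close>
    also have "- 1/2 + \<epsilon> + \<gamma> * (1 + \<epsilon>) = - \<epsilon> / 2 - 2 * \<epsilon> * \<epsilon>"
      by (simp add: \<gamma>_def field_simps)
    also have "real n powr (- \<epsilon> / 2 - 2 * \<epsilon> * \<epsilon>) \<le> real n powr (- \<epsilon> / 2)"
      using n1 by (intro powr_mono) auto
    finally show "A * z powr (1 + \<epsilon>) \<le> \<epsilon> / 4" using c1 by simp
  next
    have "clique_const k / n * (1 + 8 * l) = clique_const k / n + \<epsilon> * A / 16"
      using b n0 by (simp add: l_def field_simps)
    then show "clique_const k / n * (1 + 8 * l) \<le> \<epsilon> * A / 8" using c2 by (simp add: A_def)
  next
    have "\<gamma> * \<beta> \<le> 1/2 * 1" using \<gamma> \<beta> by (intro mult_mono) auto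
    then have "real n powr (3/2) \<le> T" unfolding T_def using n1 by (intro powr_mono) auto
    then have "4 * (real m)\<^sup>2 / T \<le> 4 * (real m)\<^sup>2 / real n powr (3/2)"
      using n0 by (intro divide_left_mono) (auto simp: T_def)
    then show "4 * (real (k choose 2))\<^sup>2 / T \<le> \<epsilon> * A / 8" using c3 by (simp add: A_def m_def)
  next
    have "real (n choose 2) \<le> real n ^ 2"
      using zero_le_square[of "real n"] by (simp add: real_choose_two power2_eq_square algebra_simps)
    then show "real (card ([{1..n}]\<^bsup>2\<^esup>)) * 1 powr ((1 - \<epsilon>) / (real (k choose 2) - 1)) \<le> real n ^ 2"
      by (simp add: card_nsets_finite)
  qed (use k n eps A0 l0 n0 in \<open>auto simp: T_def\<close>)
  also have "\<dots> \<le> real n ^ 2 * exp (- (l * A))"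
    using k n A0 by (intro potential_complete) auto
  also have "l * A = \<epsilon> / (128 * clique_const k) * real n powr (2 * \<epsilon>)"
  proof -
    \<comment> \<open>The exponent \<open>l * A\<close> is a constant times \<open>A^2 * n\<close>,
      a positive power of \<open>n\<close>, which beats the prefactor \<open>n ^ 2\<close>.\<close>
    have "A * A * real n powr 1 = real n powr (2 * \<epsilon>)"
      unfolding A_def powr_add[symmetric] by simp
    then have "A * A * n = real n powr (2 * \<epsilon>)" by simp
    then show ?thesis by (simp add: l_def field_simps)
  qed
  finally show ?thesis by (simp add: T_def \<gamma>_def)
qed

lemma final_size_whp:
  fixes k :: nat and \<delta> :: real
  assumes k: "3 \<le> k" and \<delta>: "0 < \<delta>"
  shows "(\<lambda>n. measure_pmf.prob (final_law k n ([{1..n}]\<^bsup>2\<^esup>))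
      {E. real (card E) \<le> real n powr (2 - 1 / (real k * (real k - 1) - 2) + \<delta>)}) \<longlonglongrightarrow> 1"
proof -
  define \<epsilon> where "\<epsilon> = min (\<delta> / 2) (1/8)"
  define m where "m = k choose 2"
  define \<beta> where "\<beta> = (1 - \<epsilon>) / (real m - 1)"
  define b where "b = clique_const k"
  define p where "p n = measure_pmf.prob (final_law k n ([{1..n}]\<^bsup>2\<^esup>))
      {E. real (card E) \<le> real n powr (2 - 1 / (real k * (real k - 1) - 2) + \<delta>)}" for n
  have eps: "0 < \<epsilon>" "\<epsilon> < 1/4" "\<epsilon> \<le> \<delta> / 2" using \<delta> by (auto simp: \<epsilon>_def)
  have b: "0 < b" using clique_const_pos[OF k] by (simp add: b_def)
  have m3: "3 \<le> m" using binomial_right_mono[OF k, of 2] by (simp add: m_def choose_two)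
  have expo: "2 - (1/2 - 2 * \<epsilon>) * \<beta> \<le> 2 - 1 / (real k * (real k - 1) - 2) + \<delta>"
  proof -
    have km: "real k * (real k - 1) - 2 = 2 * (real m - 1)"
      by (simp add: m_def real_choose_two)
    \<comment> \<open>The product falls short of \<open>1/2\<close> by at most
      \<open>5/2 * \<epsilon>\<close>, which is at most \<open>5/4 * \<delta>\<close> and so is
      covered by \<open>\<delta> * (m - 1) \<ge> 2 * \<delta>\<close>.\<close>
    have "(1/2 - 2 * \<epsilon>) * (1 - \<epsilon>) = 1/2 - 5/2 * \<epsilon> + 2 * (\<epsilon> * \<epsilon>)" by (simp add: field_simps)
    moreover have "0 \<le> \<epsilon> * \<epsilon>" by simp
    moreover have "\<delta> * 2 \<le> \<delta> * (real m - 1)" using m3 \<delta> by (intro mult_left_mono) auto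
    ultimately have "1/2 \<le> (1/2 - 2 * \<epsilon>) * (1 - \<epsilon>) + \<delta> * (real m - 1)" using eps \<delta> by linarith
    then have "1/2 / (real m - 1) \<le> ((1/2 - 2 * \<epsilon>) * (1 - \<epsilon>) + \<delta> * (real m - 1)) / (real m - 1)"
      using m3 by (intro divide_right_mono) auto
    also have "\<dots> = (1/2 - 2 * \<epsilon>) * \<beta> + \<delta>" using m3 by (simp add: \<beta>_def add_divide_distrib)
    finally show ?thesis unfolding km by simp
  qed
  have ev: "\<forall>\<^sub>F n in sequentially. 1 - real n ^ 2 * exp (- (\<epsilon> / (128 * b) * real n powr (2 * \<epsilon>))) \<le> p n"
  proof -
    have "\<forall>\<^sub>F n in sequentially. real n powr (- \<epsilon> / 2) \<le> \<epsilon> / 4"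
      using eps(1) by real_asymp
    moreover have "\<forall>\<^sub>F n in sequentially. b / n \<le> \<epsilon> * real n powr (- 1/2 + \<epsilon>) / 16"
      using eps b by real_asymp
    moreover have "\<forall>\<^sub>F n in sequentially.
        4 * (real m)\<^sup>2 / real n powr (3/2) \<le> \<epsilon> * real n powr (- 1/2 + \<epsilon>) / 8"
      using eps m3 by real_asymp
    ultimately show ?thesis using eventually_ge_at_top[of k]
    proof eventually_elim
      case (elim n)
      have "1 - p n = measure_pmf.prob (final_law k n ([{1..n}]\<^bsup>2\<^esup>))
          {E. real n powr (2 - 1 / (real k * (real k - 1) - 2) + \<delta>) < real (card E)}"
        unfolding p_def by (subst measure_pmf.prob_compl[symmetric]) (auto intro!: arg_cong2[where f = measure])
      also have "\<dots> \<le> measure_pmf.prob (final_law k n ([{1..n}]\<^bsup>2\<^esup>))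
          {E. real n powr (2 - (1/2 - 2 * \<epsilon>) * \<beta>) < real (card E)}"
      proof (rule measure_pmf.finite_measure_mono)
        have "real n powr (2 - (1/2 - 2 * \<epsilon>) * \<beta>) \<le>
            real n powr (2 - 1 / (real k * (real k - 1) - 2) + \<delta>)"
          using elim k by (intro powr_mono expo) auto
        then show "{E. real n powr (2 - 1 / (real k * (real k - 1) - 2) + \<delta>) < real (card E)}
            \<subseteq> {E. real n powr (2 - (1/2 - 2 * \<epsilon>) * \<beta>) < real (card E)}"
          by auto
      qed simp
      also have "\<dots> \<le> real n ^ 2 * exp (- (\<epsilon> / (128 * b) * real n powr (2 * \<epsilon>)))"
        unfolding b_def \<beta>_def m_def using elim eps k
        by (intro prob_final_large_le) (auto simp: b_def m_def)
      finally show ?case by simp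
    qed
  qed
  have lim: "(\<lambda>n. 1 - real n ^ 2 * exp (- (\<epsilon> / (128 * b) * real n powr (2 * \<epsilon>)))) \<longlonglongrightarrow> 1"
  proof -
    define c where "c = \<epsilon> / (128 * b)"
    have "c > 0" using eps b by (simp add: c_def)
    then show ?thesis unfolding c_def[symmetric] using eps(1) by real_asymp
  qed
  have "p \<longlonglongrightarrow> 1"
    by (rule tendsto_sandwich[OF ev _ lim tendsto_const]) (simp add: p_def)
  then show ?thesis unfolding p_def .
qed

section \<open>From every fixed loss in the exponent to a loss tending to 0\<close>

text \<open>At each \<open>n\<close>, take a loss just above the infimum of those \<open>d\<close>
  for which the probability is at least \<open>1 - d\<close>. Every fixed positive \<open>d\<close>
  eventually qualifies, so the infimum tends to 0.\<close>

lemma diagonal_exponent: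
  fixes g :: "real \<Rightarrow> nat \<Rightarrow> real"
  assumes mono: "\<And>d d' n. d \<le> d' \<Longrightarrow> g d n \<le> g d' n"
    and bounds: "\<And>d n. 0 \<le> g d n" "\<And>d n. g d n \<le> 1"
    and lim: "\<And>d. 0 < d \<Longrightarrow> g d \<longlonglongrightarrow> 1"
  shows "\<exists>\<epsilon>. \<epsilon> \<longlonglongrightarrow> 0 \<and> (\<lambda>n. g (\<epsilon> n) n) \<longlonglongrightarrow> 1"
proof -
  define S where "S n = {d. 0 < d \<and> 1 - d \<le> g d n}" for n
  \<comment> \<open>The infimum need not be attained; the summand \<open>1 / Suc n\<close> puts a
    member of \<open>S n\<close> strictly below \<open>\<epsilon> n\<close>, and \<open>mono\<close>
    carries its bound over.\<close>
  define \<epsilon> where "\<epsilon> n = Inf (S n) + 1 / Suc n" for n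
  have one: "1 \<in> S n" for n using bounds(1) by (simp add: S_def)
  have bdd: "bdd_below (S n)" for n by (rule bdd_belowI[of _ 0]) (simp add: S_def)
  have Inf0: "0 \<le> Inf (S n)" for n
  proof (rule cInf_greatest)
    show "S n \<noteq> {}" using one by blast
  qed (simp add: S_def)
  have "(\<lambda>n. Inf (S n)) \<longlonglongrightarrow> 0"
  proof (rule order_tendstoI)
    fix a :: real assume "a < 0"
    then show "\<forall>\<^sub>F n in sequentially. a < Inf (S n)" using Inf0 by (simp add: less_le_trans)
  next
    fix a :: real assume a: "0 < a"
    have "\<forall>\<^sub>F n in sequentially. 1 - a / 2 < g (a / 2) n"
      using lim[of "a / 2"] a by (intro order_tendstoD(1)) auto
    then show "\<forall>\<^sub>F n in sequentially. Inf (S n) < a"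
    proof eventually_elim
      case (elim n)
      then have "a / 2 \<in> S n" using a by (simp add: S_def)
      from cInf_lower[OF this bdd] a show ?case by simp
    qed
  qed
  moreover have "(\<lambda>n. 1 / real (Suc n)) \<longlonglongrightarrow> 0" by real_asymp
  ultimately have \<epsilon>: "\<epsilon> \<longlonglongrightarrow> 0" unfolding \<epsilon>_def using tendsto_add by fastforce
  have lower: "1 - \<epsilon> n \<le> g (\<epsilon> n) n" for n
  proof -
    have "Inf (S n) < \<epsilon> n" by (simp add: \<epsilon>_def)
    then obtain d where "d \<in> S n" "d < \<epsilon> n" using cInf_lessD one by blast
    then have "1 - \<epsilon> n \<le> g d n" by (simp add: S_def)
    also have "\<dots> \<le> g (\<epsilon> n) n" using \<open>d < \<epsilon> n\<close> by (intro mono) simp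
    finally show ?thesis .
  qed
  have lim: "(\<lambda>n. 1 - \<epsilon> n) \<longlonglongrightarrow> 1" using tendsto_diff[OF tendsto_const \<epsilon>, of 1] by simp
  have "(\<lambda>n. g (\<epsilon> n) n) \<longlonglongrightarrow> 1"
    by (rule tendsto_sandwich[OF always_eventually always_eventually lim tendsto_const])
      (simp_all add: lower bounds(2))
  with \<epsilon> show ?thesis by blast
qed

theorem theorem1p1:
  fixes k :: nat
  assumes "k \<ge> 4"
  shows "\<exists>\<epsilon> :: nat \<Rightarrow> real. \<epsilon> \<in> o(\<lambda>_. 1) \<and>
    (\<lambda>n. measure_pmf.prob (removal_process k n ([{1..n}]\<^bsup>2\<^esup>))
           {G. real (card (G ! hitting_time k n G))
                 \<le> real n powr (2 - 1 / (real k * (real k - 1) - 2) + \<epsilon> n)})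
      \<longlonglongrightarrow> 1"
proof -
  define g where "g d n = measure_pmf.prob (final_law k n ([{1..n}]\<^bsup>2\<^esup>))
      {E. real (card E) \<le> real n powr (2 - 1 / (real k * (real k - 1) - 2) + d)}" for d n
  have "\<exists>\<epsilon>. \<epsilon> \<longlonglongrightarrow> 0 \<and> (\<lambda>n. g (\<epsilon> n) n) \<longlonglongrightarrow> 1"
  proof (rule diagonal_exponent)
    show "g d n \<le> g d' n" if "d \<le> d'" for d d' n
    proof -
      let ?c = "2 - 1 / (real k * (real k - 1) - 2)"
      have "real n powr (?c + d) \<le> real n powr (?c + d')"
        using that by (cases "n = 0") (auto intro!: powr_mono)
      then show ?thesis
        unfolding g_def by (intro measure_pmf.finite_measure_mono) auto
    qed
    show "g d \<longlonglongrightarrow> 1" if "0 < d" for d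
      unfolding g_def using assms that by (intro final_size_whp) auto
  qed (simp_all add: g_def)
  then obtain \<epsilon> where \<epsilon>: "\<epsilon> \<longlonglongrightarrow> 0" "(\<lambda>n. g (\<epsilon> n) n) \<longlonglongrightarrow> 1" by blast
  have "\<epsilon> \<in> o(\<lambda>_. 1)" using \<epsilon>(1) by (intro smalloI_tendsto) simp_all
  moreover have "measure_pmf.prob (removal_process k n ([{1..n}]\<^bsup>2\<^esup>))
      {G. real (card (G ! hitting_time k n G))
            \<le> real n powr (2 - 1 / (real k * (real k - 1) - 2) + \<epsilon> n)} = g (\<epsilon> n) n" for n
    unfolding g_def using assms
    by (intro prob_hitting_time_eq_final_law[where
          P = "\<lambda>E. real (card E) \<le> real n powr (2 - 1 / (real k * (real k - 1) - 2) + \<epsilon> n)"]) simp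
  ultimately show ?thesis using \<epsilon>(2) by auto
qed

end
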